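(* Assume GCH. Let $\kappa$ be either a limit cardinal or $\kappa=\omega$, and fix a natural number $k\ge 1$. Then for every $n<\omega$ and every natural number $t$ with $t>k$: \[ \chi_{\rm CF}(\kappa^{+n},t,k+1)=\begin{cases}\kappa^{+(n+1-i)} & \text{if } i\cdot k<t\le (i+1)\cdot k \text{ for some } i\in\{1,\dots,n\},\\ \kappa & \text{if } (n+1)\cdot k<t.\end{cases} \]
   Context: For a family $\mathcal A$ of sets and a cardinal $\rho$, a function $f:\bigcup\mathcal A\to\rho$ is a conflict free coloring of $\mathcal A$ if for every $A\in\mathcal A$ there is $\zeta<\rho$ with $|A\cap f^{-1}\{\zeta\}|=1$; $\chi_{\rm CF}(\mathcal A)$ is the least $\rho$ for which such a coloring exists. A family $\mathcal A$ is $\mu$-almost disjoint if $|A\cap A'|<\mu$ for distinct $A,A'\in\mathcal A$. A $(\lambda,\kappa,\mu)$-system is a $\mu$-almost disjoint family $\mathcal A$ with $|\mathcal A|=\lambda$ and $|A|=\kappa$ for all $A\in\mathcal A$ (members are assumed to have at least two elements). For $\lambda\ge\kappa\ge\mu$ with $\lambda$ infinite, $\chi_{\rm CF}(\lambda,\kappa,\mu)=\sup\{\chi_{\rm CF}(\mathcal A):\mathcal A$ is a $(\lambda,\kappa,\mu)$-system$\}$. $\kappa^{+n}$ denotes the $n$-th successor cardinal of $\kappa$. *)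

theory Defs
  imports Main
begin

text \<open>Cardinals are represented by sets (via their cardinality relation card_of),
  compared with ordLeq / ordLess / ordIso from the BNF cardinal library.\<close>

definition GCH_on :: "'a itself \<Rightarrow> bool" where
  "GCH_on _ \<longleftrightarrow> (\<forall>A :: 'a set. infinite A \<longrightarrow>
       (card_of (Pow A), cardSuc (card_of A)) \<in> ordIso)"

definition cf_coloring :: "'a set set \<Rightarrow> ('a \<Rightarrow> 'c) \<Rightarrow> 'c set \<Rightarrow> bool" where
  "cf_coloring F f C \<longleftrightarrow> (\<forall>x \<in> \<Union>F. f x \<in> C) \<and>
     (\<forall>A \<in> F. \<exists>z \<in> C. card (A \<inter> f -` {z}) = 1)"

text \<open>chi_CF(F) \<le> |R|: there is a conflict free colouring using at most |R| colours
  (colours are taken from the ground type, which suffices since the identity map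
  is always a conflict free colouring).\<close>
definition chiCF_le :: "'a set set \<Rightarrow> 'b set \<Rightarrow> bool" where
  "chiCF_le F R \<longleftrightarrow> (\<exists>(f :: 'a \<Rightarrow> 'a) C. cf_coloring F f C \<and> (card_of C, card_of R) \<in> ordLeq)"

definition is_system :: "'a set set \<Rightarrow> 'b set \<Rightarrow> nat \<Rightarrow> nat \<Rightarrow> bool" where
  "is_system F L t mu \<longleftrightarrow> (card_of F, card_of L) \<in> ordIso \<and>
     (\<forall>A \<in> F. finite A \<and> card A = t \<and> 2 \<le> card A) \<and>
     (\<forall>A \<in> F. \<forall>A' \<in> F. A \<noteq> A' \<longrightarrow> card (A \<inter> A') < mu)"

text \<open>chi_CF(|L|, t, mu) = |V| (supremum over all systems with ground set in 'a):
  every system has chi_CF \<le> |V|, and no smaller cardinal is an upper bound.\<close>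
definition chiCF_sys_eq :: "'a itself \<Rightarrow> 'b set \<Rightarrow> nat \<Rightarrow> nat \<Rightarrow> 'c set \<Rightarrow> bool" where
  "chiCF_sys_eq _ L t mu V \<longleftrightarrow>
     (\<forall>F :: 'a set set. is_system F L t mu \<longrightarrow> chiCF_le F V) \<and>
     (\<forall>R :: 'a set. (card_of R, card_of V) \<in> ordLess \<longrightarrow>
        (\<exists>F :: 'a set set. is_system F L t mu \<and> \<not> chiCF_le F R))"

end

theory Submission
  imports Defs "HOL-Library.Ramsey"
begin

text \<open>
  Upper bound. Close the initial segments of a vertex set of size \<open>\<kappa>\<^sup>+\<^sup>j\<close> under: a member meeting the set
  in more than \<open>k\<close> points is contained in it. Almost disjointness keeps the closures small. Every
  member has at most \<open>k\<close> points of rank below its top rank, so cutting the members down to their top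
  blocks costs \<open>k\<close> points and one successor step. After \<open>j\<close> steps there is a well-founded relation in
  which every member has a greatest element and every vertex is greatest in fewer than \<open>\<kappa>\<close> members;
  colouring greedily, each greatest element gets a colour that is unique in its member.

  Lower bound for \<open>i \<ge> 2\<close>, \<open>t = i k + q\<close>. The vertices are pairs of an \<open>i\<close>-subset of \<open>X\<close> and a number below \<open>k\<close>; the
  members are the \<open>i\<close>-subsets of an \<open>(i+1)\<close>-subset, each taken \<open>k\<close> times, except for one taken \<open>q\<close>
  times. Two members share at most one \<open>i\<close>-subset, hence at most \<open>k\<close> vertices. By the Erdos-Rado
  theorem (with exponents collapsed by GCH) some member repeats all its colours. For \<open>i = 1\<close> and
  \<open>q < k\<close> the exceptional facet could have a unique colour, and a diagonalization against all bounded
  subsets of the successor cardinal replaces the partition relation. For finitely many colours, the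
  finite Ramsey theorem suffices.
\<close>

unbundle cardinal_syntax

section \<open>Cardinal bounds for lists, finite subsets and unions\<close>

lemma card_of_not_ordLess: "\<not> |A| <o |B| \<longleftrightarrow> |B| \<le>o |A|"
  by (rule not_ordLess_iff_ordLeq[OF card_of_Well_order card_of_Well_order])

lemma card_of_not_ordLeq: "\<not> |A| \<le>o |B| \<longleftrightarrow> |B| <o |A|"
  by (rule not_ordLeq_iff_ordLess[OF card_of_Well_order card_of_Well_order])

lemma finite_ordLess_infinite_card: "finite A \<Longrightarrow> infinite B \<Longrightarrow> |A| <o |B|"
  using card_of_ordLeq_finite[of B A] card_of_not_ordLeq[of B A] by blast

lemma card_of_Times_ordLeq:
  assumes "infinite D" "|A| \<le>o |D|" "|B| \<le>o |D|"
  shows "|A \<times> B| \<le>o |D|"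
  using card_of_Sigma_ordLeq_infinite[of D A "\<lambda>_. B"] assms by blast

lemma card_of_Un_ordLeq:
  assumes "infinite D" "|A| \<le>o |D|" "|B| \<le>o |D|"
  shows "|A \<union> B| \<le>o |D|"
proof -
  have "|A \<union> B| \<le>o |A <+> B|" by (rule card_of_Un_Plus_ordLeq)
  also have "|A <+> B| \<le>o |D|"
    using card_of_Plus_ordLeq_infinite_Field[of "|D|" A B] assms
    by (simp add: Field_card_of card_of_card_order_on)
  finally (ordLeq_transitive) show ?thesis .
qed

lemma card_of_image_ordLeq: "|A| \<le>o r \<Longrightarrow> |f ` A| \<le>o r"
  by (rule ordLeq_transitive[OF card_of_image])

lemma card_of_subset_ordLeq: "A \<subseteq> B \<Longrightarrow> |B| \<le>o r \<Longrightarrow> |A| \<le>o r"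
  by (rule ordLeq_transitive[OF card_of_mono1])

lemma card_of_lists_ordLeq_infinite:
  assumes "infinite D" "|X| \<le>o |D|"
  shows "|lists X| \<le>o |D|"
proof -
  have len: "|{xs \<in> lists X. length xs = n}| \<le>o |D|" for n
  proof (induction n)
    case 0
    have "{xs \<in> lists X. length xs = 0} = {[]}" by auto
    then show ?case
      using assms(1) finite_ordLess_infinite_card[of "{[]}" D] ordLess_imp_ordLeq by auto
  next
    case (Suc n)
    have "{xs \<in> lists X. length xs = Suc n}
        \<subseteq> (\<lambda>(x, xs). x # xs) ` (X \<times> {xs \<in> lists X. length xs = n})" (is "?L \<subseteq> ?f ` ?P")
    proof
      fix xs assume "xs \<in> ?L"
      then obtain y ys where "xs = y # ys" "y \<in> X" "ys \<in> lists X" "length ys = n"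
        by (cases xs) auto
      then show "xs \<in> ?f ` ?P" by (intro image_eqI[of _ _ "(y, ys)"]) auto
    qed
    then show ?case
      by (rule card_of_subset_ordLeq) (intro card_of_image_ordLeq card_of_Times_ordLeq assms Suc)
  qed
  have "lists X = (\<Union>n\<in>UNIV. {xs \<in> lists X. length xs = n})" by auto
  moreover have "|\<Union>n\<in>UNIV. {xs \<in> lists X. length xs = n}| \<le>o |D|"
    using assms(1) len by (intro card_of_UNION_ordLeq_infinite) (auto simp: infinite_iff_card_of_nat)
  ultimately show ?thesis by simp
qed

lemma card_of_Fpow_ordLeq_infinite:
  assumes "infinite D" "|X| \<le>o |D|"
  shows "|Fpow X| \<le>o |D|"
proof -
  have "Fpow X \<subseteq> set ` lists X"
  proof
    fix A assume "A \<in> Fpow X"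
    then obtain xs where "set xs = A" "A \<subseteq> X" using finite_list unfolding Fpow_def by blast
    then show "A \<in> set ` lists X" by auto
  qed
  then show ?thesis
    by (rule card_of_subset_ordLeq) (intro card_of_image_ordLeq card_of_lists_ordLeq_infinite assms)
qed

lemma card_of_Fpow_ordLess_infinite:
  assumes "infinite D" "|X| <o |D|"
  shows "|Fpow X| <o |D|"
proof (cases "finite X")
  case True
  then have "finite (Fpow X)" by (simp add: Fpow_Pow_finite)
  then show ?thesis by (rule finite_ordLess_infinite_card[OF _ assms(1)])
next
  case False
  then have "|Fpow X| \<le>o |X|"
    by (rule card_of_Fpow_ordLeq_infinite) (rule card_of_mono1[OF order_refl])
  then show ?thesis by (rule ordLeq_ordLess_trans[OF _ assms(2)])
qed

text \<open>An infinite \<open>I\<close> has a union of size at most \<open>|I|\<close>, a finite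
  one a finite union. So the bound holds for singular \<open>|D|\<close> as well, which matters as
  \<open>\<kappa>\<close> may be a singular limit.\<close>

lemma card_of_Union_finite_ordLess:
  assumes "infinite D" "|I| <o |D|" "\<And>A. A \<in> I \<Longrightarrow> finite A"
  shows "|\<Union>I| <o |D|"
proof (cases "finite I")
  case True
  then show ?thesis using assms by (intro finite_ordLess_infinite_card) auto
next
  case False
  have "|\<Union>A\<in>I. A| \<le>o |I|"
    using False assms
    by (intro card_of_UNION_ordLeq_infinite card_of_mono1 order_refl ballI ordLess_imp_ordLeq
        finite_ordLess_infinite_card) auto
  then show ?thesis using ordLeq_ordLess_trans[OF _ assms(2)] by simp
qed

section \<open>Greedy colouring along a well-founded relation\<close>

text \<open>Well-founded recursion: the values on \<open>N v\<close> are already fixed and are fewer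
  than \<open>|C v|\<close>, so one is left over. The lists \<open>C v\<close> vary with
  \<open>v\<close> so that the lemma yields colourings as well as distinct representatives.\<close>

lemma greedy_choice:
  assumes wf: "wf s" and N: "\<And>v. N v \<subseteq> {u. (u, v) \<in> s}"
    and less: "\<And>v. v \<in> V \<Longrightarrow> |N v| <o |C v|"
  shows "\<exists>f. \<forall>v\<in>V. f v \<in> C v \<and> f v \<notin> f ` N v"
proof -
  define f where "f = wfrec s (\<lambda>f v. SOME c. c \<in> C v - f ` N v)"
  have f: "f v = (SOME c. c \<in> C v - f ` N v)" for v
  proof -
    have "cut f s v ` N v = f ` N v" using N by (auto simp: cut_def image_def)
    then show ?thesis using def_wfrec[OF f_def[THEN eq_reflection] wf, of v] by simp
  qed
  have "f v \<in> C v - f ` N v" if "v \<in> V" for v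
  proof -
    have "|f ` N v| <o |C v|" by (rule ordLeq_ordLess_trans[OF card_of_image less[OF that]])
    then have "C v - f ` N v \<noteq> {}"
      using card_of_mono1[of "C v" "f ` N v"] card_of_not_ordLeq[of "C v" "f ` N v"] by blast
    then show ?thesis using some_in_eq[of "C v - f ` N v"] f[of v] by simp
  qed
  then show ?thesis by blast
qed

text \<open>In these members \<open>v\<close> is the greatest element, relative to a relation that
  will only be well-founded; asymmetry then makes the greatest element of a member unique.\<close>

definition topped :: "('v \<times> 'v) set \<Rightarrow> 'v set set \<Rightarrow> 'v \<Rightarrow> 'v set set" where
  "topped s F v = {A \<in> F. v \<in> A \<and> (\<forall>u \<in> A - {v}. (u, v) \<in> s)}"

text \<open>Only the greatest element of a member has to get a colour of its own. The members topped
  by \<open>v\<close> are fewer than \<open>|C|\<close> finite sets, so fewer than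
  \<open>|C|\<close> colours are forbidden at \<open>v\<close>.\<close>

lemma coloring_of_topped:
  assumes wf: "wf s" and C: "infinite C"
    and fin: "\<And>A. A \<in> F \<Longrightarrow> finite A"
    and top: "\<And>A. A \<in> F \<Longrightarrow> \<exists>v. A \<in> topped s F v"
    and few: "\<And>v. |topped s F v| <o |C|"
  shows "\<exists>f. range f \<subseteq> C \<and> (\<forall>A\<in>F. \<exists>v\<in>A. \<forall>u\<in>A - {v}. f u \<noteq> f v)"
proof -
  define N where "N v = \<Union>(topped s F v) - {v}" for v
  have "|N v| <o |C|" for v
  proof -
    have "|\<Union>(topped s F v)| <o |C|"
      using card_of_Union_finite_ordLess[OF C few] fin unfolding topped_def by blast
    then show ?thesis unfolding N_def
      by (rule ordLeq_ordLess_trans[OF card_of_mono1[OF Diff_subset]])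
  qed
  moreover have "N v \<subseteq> {u. (u, v) \<in> s}" for v unfolding N_def topped_def by auto
  ultimately obtain f where f: "\<forall>v\<in>UNIV. f v \<in> C \<and> f v \<notin> f ` N v"
    using greedy_choice[OF wf, of N UNIV "\<lambda>_. C"] by blast
  have "\<exists>v\<in>A. \<forall>u\<in>A - {v}. f u \<noteq> f v" if A: "A \<in> F" for A
  proof -
    obtain v where v: "A \<in> topped s F v" using top A by blast
    then have "A - {v} \<subseteq> N v" unfolding N_def by blast
    moreover have "f v \<notin> f ` N v" using f by blast
    ultimately have "\<forall>u\<in>A - {v}. f u \<noteq> f v" by (metis image_eqI subsetD)
    then show ?thesis using v unfolding topped_def by blast
  qed
  then show ?thesis using f by blast
qed

section \<open>Closure under members met in more than \<open>k\<close> points\<close>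

definition hull :: "nat \<Rightarrow> 'v set set \<Rightarrow> 'v set \<Rightarrow> 'v set" where
  "hull k F X = \<Inter>{Y. X \<subseteq> Y \<and> (\<forall>A\<in>F. k < card (A \<inter> Y) \<longrightarrow> A \<subseteq> Y)}"

lemma hull_superset: "X \<subseteq> hull k F X"
  unfolding hull_def by blast

lemma hull_mono: "X \<subseteq> Y \<Longrightarrow> hull k F X \<subseteq> hull k F Y"
  unfolding hull_def by blast

text \<open>Every closed \<open>Y\<close> above \<open>X\<close> meets the finite set
  \<open>A\<close> in at least as many points as the hull does, so every such \<open>Y\<close>
  absorbs \<open>A\<close>.\<close>

lemma hull_closed:
  assumes "A \<in> F" "finite A" "k < card (A \<inter> hull k F X)"
  shows "A \<subseteq> hull k F X"
proof -
  have "A \<subseteq> Y" if Y: "X \<subseteq> Y" "\<forall>A\<in>F. k < card (A \<inter> Y) \<longrightarrow> A \<subseteq> Y" for Y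
  proof -
    have "hull k F X \<subseteq> Y" using Y unfolding hull_def by blast
    then have "card (A \<inter> hull k F X) \<le> card (A \<inter> Y)"
      using assms(2) by (intro card_mono) auto
    then show ?thesis using Y assms by auto
  qed
  then show ?thesis unfolding hull_def by blast
qed

lemma card_of_sets_meeting:
  assumes D: "infinite D" "|Y| \<le>o |D|"
    and fin: "\<And>A. A \<in> F \<Longrightarrow> finite A"
    and ad: "\<And>A B. A \<in> F \<Longrightarrow> B \<in> F \<Longrightarrow> A \<noteq> B \<Longrightarrow> card (A \<inter> B) \<le> k"
  shows "|{A \<in> F. k < card (A \<inter> Y)}| \<le>o |D|"
proof -
  let ?M = "{A \<in> F. k < card (A \<inter> Y)}"
  \<comment> \<open>More than \<open>k\<close> points determine a member.\<close>
  have "inj_on (\<lambda>A. A \<inter> Y) ?M"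
  proof (rule inj_onI, rule ccontr)
    fix A B assume AB: "A \<in> ?M" "B \<in> ?M" "A \<inter> Y = B \<inter> Y" "A \<noteq> B"
    have "card (A \<inter> Y) \<le> card (A \<inter> B)" using AB fin by (intro card_mono) auto
    then show False using AB ad[of A B] by auto
  qed
  moreover have "(\<lambda>A. A \<inter> Y) ` ?M \<subseteq> Fpow Y" using fin by (auto simp: Fpow_def)
  ultimately have "|?M| \<le>o |Fpow Y|" using card_of_ordLeq by blast
  then show ?thesis by (rule ordLeq_transitive[OF _ card_of_Fpow_ordLeq_infinite[OF D]])
qed

text \<open>The hull lies in the union of \<open>\<omega>\<close> rounds. Each round adds at most
  \<open>|D|\<close> finite members, and the union is closed because the finite trace of a member is
  already contained in one round.\<close>

lemma card_of_hull:
  assumes D: "infinite D" "|X| \<le>o |D|"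
    and fin: "\<And>A. A \<in> F \<Longrightarrow> finite A"
    and ad: "\<And>A B. A \<in> F \<Longrightarrow> B \<in> F \<Longrightarrow> A \<noteq> B \<Longrightarrow> card (A \<inter> B) \<le> k"
  shows "|hull k F X| \<le>o |D|"
proof -
  define Z where "Z n = ((\<lambda>Y. Y \<union> \<Union>{A \<in> F. k < card (A \<inter> Y)}) ^^ n) X" for n
  have Z0: "Z 0 = X" and ZS: "Z (Suc n) = Z n \<union> \<Union>{A \<in> F. k < card (A \<inter> Z n)}" for n
    unfolding Z_def by auto
  have small: "|Z n| \<le>o |D|" for n
  proof (induction n)
    case 0
    then show ?case using D Z0 by simp
  next
    case (Suc n)
    have few: "|{A \<in> F. k < card (A \<inter> Z n)}| \<le>o |D|"
      by (rule card_of_sets_meeting[OF D(1) Suc fin ad])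
    have "|A| \<le>o |D|" if "A \<in> F" for A
      by (rule ordLess_imp_ordLeq[OF finite_ordLess_infinite_card[OF fin[OF that] D(1)]])
    then have "|\<Union>A\<in>{A \<in> F. k < card (A \<inter> Z n)}. A| \<le>o |D|"
      by (intro card_of_UNION_ordLeq_infinite[OF D(1) few]) blast
    then show ?case using card_of_Un_ordLeq[OF D(1) Suc] unfolding ZS by simp
  qed
  have mono: "Z m \<subseteq> Z n" if "m \<le> n" for m n
    using lift_Suc_mono_le[of Z, OF _ that] ZS by blast
  have "A \<subseteq> (\<Union>n. Z n)" if A: "A \<in> F" "k < card (A \<inter> (\<Union>n. Z n))" for A
  proof -
    have "\<exists>n. A \<inter> (\<Union>n. Z n) \<subseteq> Z n"
    proof -
      have "\<exists>n. T \<subseteq> Z n" if "finite T" "T \<subseteq> (\<Union>n. Z n)" for T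
        using that
      proof (induction T)
        case (insert x T)
        then obtain m n where "T \<subseteq> Z m" "x \<in> Z n" by auto
        then have "insert x T \<subseteq> Z (max m n)" using mono[of m "max m n"] mono[of n "max m n"] by auto
        then show ?case by blast
      qed auto
      then show ?thesis using fin[OF A(1)] by auto
    qed
    then obtain n where n: "A \<inter> (\<Union>n. Z n) \<subseteq> Z n" by blast
    then have "A \<inter> (\<Union>n. Z n) = A \<inter> Z n" by auto
    then have "A \<subseteq> Z (Suc n)" using A unfolding ZS by auto
    then show ?thesis by blast
  qed
  moreover have "X \<subseteq> (\<Union>n. Z n)" using Z0 by blast
  ultimately have "hull k F X \<subseteq> (\<Union>n. Z n)" unfolding hull_def by (intro Inter_lower) simp
  moreover have "|\<Union>n\<in>UNIV. Z n| \<le>o |D|"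
    using D small by (intro card_of_UNION_ordLeq_infinite) (auto simp: infinite_iff_card_of_nat)
  ultimately show ?thesis by (rule card_of_subset_ordLeq)
qed

section \<open>Well-founded relations with greatest elements, and the upper bound\<close>

lemma topped_singletonI: "A \<in> F \<Longrightarrow> v \<in> A \<Longrightarrow> (\<And>u. u \<in> A \<Longrightarrow> u \<noteq> v \<Longrightarrow> (u, v) \<in> s) \<Longrightarrow> A \<in> topped s F v"
  unfolding topped_def by blast

lemma card_of_insert_ordLess:
  assumes "infinite D" "|X| <o |D|"
  shows "|insert x X| <o |D|"
  using card_of_Un_ordLess_infinite[OF assms(1) finite_ordLess_infinite_card[of "{x}", OF _ assms(1)] assms(2)]
  by simp

lemma card_of_insert_ordLeq:
  assumes "infinite D" "|X| \<le>o |D|"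
  shows "|insert x X| \<le>o |D|"
  using card_of_Un_ordLeq[OF assms(1) ordLess_imp_ordLeq[OF finite_ordLess_infinite_card[of "{x}", OF _ assms(1)]] assms(2)]
  by simp

lemma wo_rel_card_of: "wo_rel |A|"
  by (simp add: wo_rel_def card_of_Well_order)

lemma finite_has_max_card_of:
  assumes "finite A" "A \<noteq> {}" "A \<subseteq> V"
  shows "\<exists>v\<in>A. \<forall>u\<in>A. (u, v) \<in> |V|"
  using assms
proof (induction A rule: finite_ne_induct)
  case (singleton x)
  then show ?case
    using card_of_well_order_on[of V] by (auto simp: order_on_defs refl_on_def)
next
  case (insert x A)
  then obtain v where v: "v \<in> A" "\<forall>u\<in>A. (u, v) \<in> |V|" by auto
  have "refl_on V |V|" "trans |V|" "total_on V |V|"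
    using card_of_well_order_on[of V] by (auto simp: order_on_defs)
  then have "(x, x) \<in> |V|" "(x, v) \<in> |V| \<or> (v, x) \<in> |V|"
    using insert.prems v(1) by (cases "x = v"; auto simp: total_on_def refl_on_def)+
  from this(2) show ?case
  proof
    assume "(x, v) \<in> |V|"
    then show ?thesis using v by (intro bexI[of _ v]) auto
  next
    assume "(v, x) \<in> |V|"
    then show ?thesis
      using v \<open>(x, x) \<in> |V|\<close> \<open>trans |V|\<close> by (intro bexI[of _ x]) (auto dest: transD)
  qed
qed

text \<open>The order \<open>|V|\<close> has least possible type, so the segment up to
  \<open>v\<close> has fewer than \<open>|D|\<close> points, hence fewer than \<open>|D|\<close>
  finite subsets; members topped by \<open>v\<close> are among them.\<close>

lemma card_of_tops_small:
  assumes D: "infinite D" "|V| \<le>o |D|"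
    and fin: "\<And>A. A \<in> F \<Longrightarrow> A \<subseteq> V \<and> finite A"
  shows "|topped ( |V| - Id) F v| <o |D|"
proof -
  have "|insert v (underS |V| v)| <o |D|"
  proof (cases "v \<in> V")
    case True
    then have "|underS |V| v| <o |V|"
      by (intro card_of_underS card_of_Card_order) (simp add: Field_card_of)
    then show ?thesis
      by (intro card_of_insert_ordLess D ordLess_ordLeq_trans[OF _ D(2)])
  next
    case False
    then have "underS |V| v = {}"
      using Field_card_of[of V] unfolding underS_def Field_def by auto
    then show ?thesis using D by (simp add: finite_ordLess_infinite_card)
  qed
  then have "|Fpow (insert v (underS |V| v))| <o |D|"
    by (rule card_of_Fpow_ordLess_infinite[OF D(1)])
  moreover have "topped ( |V| - Id) F v \<subseteq> Fpow (insert v (underS |V| v))"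
    using fin unfolding topped_def Fpow_def underS_def by auto
  ultimately show ?thesis using ordLeq_ordLess_trans[OF card_of_mono1] by blast
qed

text \<open>Induction on \<open>j\<close>, with \<open>V\<close> and \<open>F\<close> general
  because the hypothesis is used inside every block. At \<open>j = 0\<close> the cardinal well-order
  of \<open>V\<close> works; each step spends \<open>k\<close> points of every member to lower the
  vertex set by one successor.\<close>

lemma exists_order:
  fixes Q :: "nat \<Rightarrow> 'c set" and V :: "'v set"
  assumes inf: "\<And>m. m \<le> j \<Longrightarrow> infinite (Q m)"
    and succ: "\<And>m. m < j \<Longrightarrow> |Q (Suc m)| \<le>o cardSuc |Q m|"
    and V: "|V| \<le>o |Q j|"
    and F: "\<And>A. A \<in> F \<Longrightarrow> A \<subseteq> V \<and> finite A \<and> Suc j * k < card A"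
    and ad: "\<And>A B. A \<in> F \<Longrightarrow> B \<in> F \<Longrightarrow> A \<noteq> B \<Longrightarrow> card (A \<inter> B) \<le> k"
  shows "\<exists>s. wf s \<and> (\<forall>A\<in>F. \<exists>v. A \<in> topped s F v) \<and> (\<forall>v. |topped s F v| <o |Q 0| )"
  using inf succ V F ad
proof (induction j arbitrary: V F)
  case 0
  have "wf ( |V| - Id)" using card_of_well_order_on[of V] by (simp add: well_order_on_def)
  moreover have "\<exists>v. A \<in> topped ( |V| - Id) F v" if A: "A \<in> F" for A
  proof -
    have "finite A" "A \<noteq> {}" "A \<subseteq> V" using 0(4)[OF A] by auto
    then obtain v where "v \<in> A" "\<forall>u\<in>A. (u, v) \<in> |V|" using finite_has_max_card_of by blast
    then have "A \<in> topped ( |V| - Id) F v" using A by (intro topped_singletonI) auto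
    then show ?thesis by blast
  qed
  moreover have "|topped ( |V| - Id) F v| <o |Q 0|" for v
    using 0 by (intro card_of_tops_small) auto
  ultimately show ?case by blast
next
  case (Suc j)
  let ?r = "|V|"
  interpret r: wo_rel "?r" by (rule wo_rel_card_of)
  have fld: "Field ?r = V" by (rule Field_card_of)
  \<comment> \<open>The sets \<open>cl v\<close> increase with \<open>v\<close> and exhaust
    \<open>V\<close>; \<open>rk u\<close> is the first index whose closure contains
    \<open>u\<close>, and the blocks \<open>B v\<close> partition \<open>V\<close> by rank.\<close>
  define cl where "cl v = hull k F (under ?r v)" for v
  define rk where "rk u = r.minim {v \<in> V. u \<in> cl v}" for u
  define B where "B v = {u \<in> V. rk u = v}" for v
  have fin: "finite A" "A \<subseteq> V" "A \<noteq> {}" if "A \<in> F" for A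
    using Suc.prems(4)[OF that] by auto
  have refl: "(v, v) \<in> ?r" if "v \<in> V" for v
    using r.REFL that fld by (auto simp: refl_on_def)
  have self: "u \<in> cl u" if "u \<in> V" for u
    unfolding cl_def using hull_superset refl[OF that] by (fastforce simp: under_def)
  have rk: "rk u \<in> V" "u \<in> cl (rk u)" if "u \<in> V" for u
    using r.minim_in[of "{v \<in> V. u \<in> cl v}"] self[OF that] that fld unfolding rk_def by auto
  have rk_least: "(rk u, v) \<in> ?r" if "u \<in> cl v" "v \<in> V" for u v
    unfolding rk_def using r.minim_least[of "{v \<in> V. u \<in> cl v}" v] that fld by auto
  have cl_mono: "cl v \<subseteq> cl w" if "(v, w) \<in> ?r" for v w
    unfolding cl_def using r.TRANS that
    by (intro hull_mono) (auto simp: under_def dest: transD)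
  have strict: "wf (?r - Id)" by (rule r.WF)
  have total: "(v, w) \<in> ?r \<or> (w, v) \<in> ?r" if "v \<in> V" "w \<in> V" for v w
    using r.TOTALS that fld by blast

  have Qj: "infinite (Q j)" using Suc.prems(1) by simp
  have seg: "|under ?r v| \<le>o |Q j|" if v: "v \<in> V" for v
  proof -
    have "|underS ?r v| <o ?r"
      using v fld by (intro card_of_underS card_of_Card_order) auto
    also have "?r \<le>o cardSuc |Q j|"
      using ordLeq_transitive[OF Suc.prems(3) Suc.prems(2)[of j]] by simp
    finally (ordLess_ordLeq_trans) have "|underS ?r v| \<le>o |Q j|"
      using cardSuc_ordLeq_ordLess[OF card_of_Card_order card_of_Card_order] by blast
    then have "|insert v (underS ?r v)| \<le>o |Q j|" by (rule card_of_insert_ordLeq[OF Qj])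
    moreover have "under ?r v \<subseteq> insert v (underS ?r v)" unfolding under_def underS_def by auto
    ultimately show ?thesis using card_of_subset_ordLeq by blast
  qed
  have B_small: "|B v| \<le>o |Q j|" for v
  proof (cases "v \<in> V")
    case True
    have "|cl v| \<le>o |Q j|"
      unfolding cl_def by (rule card_of_hull[OF Qj seg[OF True] fin(1) Suc.prems(5)])
    moreover have "B v \<subseteq> cl v" using rk unfolding B_def by auto
    ultimately show ?thesis using card_of_subset_ordLeq by blast
  next
    case False
    then have "B v = {}" using rk(1) unfolding B_def by auto
    then show ?thesis by (simp add: card_of_empty)
  qed

  define E where "E v = {A \<in> F. (\<exists>u\<in>A. rk u = v) \<and> (\<forall>u\<in>A. (rk u, v) \<in> ?r)}" for v
  have enters: "\<exists>v. A \<in> E v" if A: "A \<in> F" for A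
  proof -
    obtain v where "v \<in> rk ` A" "\<forall>w\<in>rk ` A. (w, v) \<in> ?r"
      using finite_has_max_card_of[of "rk ` A" V] fin[OF A] rk(1) by blast
    then show ?thesis using A unfolding E_def by auto
  qed
  \<comment> \<open>Suppose more than \<open>k\<close> points of \<open>A\<close> lie below the top
    rank \<open>v\<close>, and let \<open>w\<close> be the largest of their ranks. They all lie in
    \<open>cl w\<close>, which therefore contains \<open>A\<close>; then no point of
    \<open>A\<close> has rank \<open>v\<close>.\<close>
  have old: "card (A - B v) \<le> k" if A: "A \<in> E v" for A v
  proof (rule ccontr)
    assume neg: "\<not> card (A - B v) \<le> k"
    have AF: "A \<in> F" using A unfolding E_def by auto
    have "A - B v \<noteq> {}" using neg by (metis card.empty le0)
    then obtain w where w: "w \<in> rk ` (A - B v)" "\<forall>u\<in>A - B v. (rk u, w) \<in> ?r"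
      using finite_has_max_card_of[of "rk ` (A - B v)" V] fin[OF AF] rk(1) by blast
    then obtain x where x: "x \<in> A" "x \<notin> B v" "w = rk x" by blast
    have wV: "w \<in> V" "w \<noteq> v" "(w, v) \<in> ?r"
      using x fin[OF AF] rk(1) A unfolding B_def E_def by auto
    have "A - B v \<subseteq> cl w"
      using w(2) rk(2) cl_mono fin(2)[OF AF] by blast
    then have "card (A - B v) \<le> card (A \<inter> cl w)"
      using fin(1)[OF AF] by (intro card_mono) auto
    then have sub: "A \<subseteq> cl w"
      using neg hull_closed[OF AF fin(1)[OF AF], of k "under ?r w"] unfolding cl_def by linarith
    obtain y where y: "y \<in> A" "rk y = v" using A unfolding E_def by auto
    then have "(v, w) \<in> ?r" using rk_least[of y w] sub wV by auto
    then show False using wV r.ANTISYM by (auto dest: antisymD)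
  qed
  \<comment> \<open>The induction hypothesis inside block \<open>v\<close>: after the loss of at
    most \<open>k\<close> points, the trace of a member still has more than \<open>Suc j * k\<close>
    points.\<close>
  have "\<exists>S. wf S \<and> (\<forall>A\<in>(\<lambda>A. A \<inter> B v) ` E v. \<exists>u. A \<in> topped S ((\<lambda>A. A \<inter> B v) ` E v) u)
      \<and> (\<forall>u. |topped S ((\<lambda>A. A \<inter> B v) ` E v) u| <o |Q 0| )" for v
  proof (rule Suc.IH)
    show "infinite (Q m)" if "m \<le> j" for m using Suc.prems(1) that by simp
    show "|Q (Suc m)| \<le>o cardSuc |Q m|" if "m < j" for m using Suc.prems(2) that by simp
    show "|B v| \<le>o |Q j|" by (rule B_small)
    fix A' assume "A' \<in> (\<lambda>A. A \<inter> B v) ` E v"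
    then obtain A where A: "A' = A \<inter> B v" "A \<in> E v" by blast
    then have AF: "A \<in> F" unfolding E_def by auto
    have "card A = card (A \<inter> B v) + card (A - B v)"
      using fin(1)[OF AF] by (simp add: card_Int_Diff)
    then have "Suc j * k < card (A \<inter> B v)"
      using old[OF A(2)] Suc.prems(4)[OF AF] by auto
    then show "A' \<subseteq> B v \<and> finite A' \<and> Suc j * k < card A'" using A fin(1)[OF AF] by auto
    fix C' assume "C' \<in> (\<lambda>A. A \<inter> B v) ` E v" "A' \<noteq> C'"
    then obtain C where C: "C' = C \<inter> B v" "C \<in> F" "A \<noteq> C" using A unfolding E_def by blast
    have "card (A' \<inter> C') \<le> card (A \<inter> C)" using A C fin(1)[OF AF] by (intro card_mono) auto
    then show "card (A' \<inter> C') \<le> k" using Suc.prems(5)[OF AF C(2,3)] by simp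
  qed
  then obtain S where S: "\<And>v. wf (S v)"
      "\<And>v A. A \<in> E v \<Longrightarrow> \<exists>u. A \<inter> B v \<in> topped (S v) ((\<lambda>A. A \<inter> B v) ` E v) u"
      "\<And>u v. |topped (S v) ((\<lambda>A. A \<inter> B v) ` E v) u| <o |Q 0|"
    by (metis imageI)

  \<comment> \<open>Lexicographic: first by rank, inside a block by the relation of the induction hypothesis.\<close>
  define s where "s = {(u, w). u \<in> V \<and> w \<in> V \<and>
    ((rk u, rk w) \<in> ?r - Id \<or> rk u = rk w \<and> (u, w) \<in> S (rk w))}"
  have "wf s"
  proof (rule wfI_min)
    fix x :: 'v and X assume "x \<in> X"
    show "\<exists>z\<in>X. \<forall>y. (y, z) \<in> s \<longrightarrow> y \<notin> X"
    proof (cases "x \<in> V")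
      case True
      then obtain v where v: "v \<in> rk ` (X \<inter> V)" "\<And>w. (w, v) \<in> ?r - Id \<Longrightarrow> w \<notin> rk ` (X \<inter> V)"
        using wfE_min[OF strict, of "rk x" "rk ` (X \<inter> V)"] \<open>x \<in> X\<close> by blast
      then obtain y where "y \<in> {u \<in> X \<inter> V. rk u = v}" by blast
      then obtain z where "z \<in> {u \<in> X \<inter> V. rk u = v}"
          "\<And>y. (y, z) \<in> S v \<Longrightarrow> y \<notin> {u \<in> X \<inter> V. rk u = v}"
        using wfE_min[OF S(1)[of v], of y "{u \<in> X \<inter> V. rk u = v}"] by blast
      then show ?thesis using v(2) unfolding s_def by (intro bexI[of _ z]) auto
    next
      case False
      then show ?thesis using \<open>x \<in> X\<close> unfolding s_def by blast
    qed
  qed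
  moreover have "\<exists>v. A \<in> topped s F v" if A: "A \<in> F" for A
  proof -
    obtain v where v: "A \<in> E v" using enters[OF A] by blast
    then obtain w where w: "w \<in> A \<inter> B v" "\<forall>u\<in>A \<inter> B v - {w}. (u, w) \<in> S v"
      using S(2)[OF v] unfolding topped_def by blast
    have "(u, w) \<in> s" if u: "u \<in> A" "u \<noteq> w" for u
    proof (cases "rk u = v")
      case True
      then show ?thesis using u w fin(2)[OF A] unfolding s_def B_def by auto
    next
      case False
      then have "(rk u, v) \<in> ?r - Id" using u v unfolding E_def by auto
      then show ?thesis using u w fin(2)[OF A] unfolding s_def B_def by auto
    qed
    then have "A \<in> topped s F w" using A w by (intro topped_singletonI) auto
    then show ?thesis by blast
  qed
  moreover have "|topped s F w| <o |Q 0|" for w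
  proof -
    let ?v = "rk w"
    let ?T = "topped (S ?v) ((\<lambda>A. A \<inter> B ?v) ` E ?v) w"
    \<comment> \<open>Ranks never decrease along \<open>s\<close>, so a member with greatest element
      \<open>w\<close> has top rank \<open>rk w\<close>.\<close>
    have inE: "A \<in> E ?v" "A \<inter> B ?v \<in> ?T" if "A \<in> topped s F w" for A
    proof -
      have A: "A \<in> F" "w \<in> A" "\<forall>u\<in>A - {w}. (u, w) \<in> s" using that unfolding topped_def by auto
      have wV: "w \<in> V" using A fin(2) by blast
      have "(rk u, ?v) \<in> ?r" if "u \<in> A" for u
      proof (cases "u = w")
        case True
        then show ?thesis using refl[OF rk(1)[OF wV]] by simp
      next
        case False
        then have "(u, w) \<in> s" using A(3) that by blast
        then show ?thesis using refl[OF rk(1)[OF wV]] unfolding s_def by auto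
      qed
      then show E: "A \<in> E ?v" using A unfolding E_def by blast
      have "(u, w) \<in> S ?v" if "u \<in> A \<inter> B ?v - {w}" for u
        using A(3) that unfolding s_def B_def by auto
      then show "A \<inter> B ?v \<in> ?T"
        using E A wV unfolding topped_def by (auto simp: B_def)
    qed
    \<comment> \<open>A trace has more than \<open>k\<close> points and so determines its member;
      the bound on the traces topped by \<open>w\<close> carries over to the members.\<close>
    have "inj_on (\<lambda>A. A \<inter> B ?v) (topped s F w)"
    proof (rule inj_onI, rule ccontr)
      fix A C assume AC: "A \<in> topped s F w" "C \<in> topped s F w" "A \<inter> B ?v = C \<inter> B ?v" "A \<noteq> C"
      have AF: "A \<in> F" "C \<in> F" using AC unfolding topped_def by auto
      have "card A = card (A \<inter> B ?v) + card (A - B ?v)"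
        using fin(1)[OF AF(1)] by (simp add: card_Int_Diff)
      then have "k < card (A \<inter> B ?v)"
        using old[OF inE(1)[OF AC(1)]] Suc.prems(4)[OF AF(1)] by auto
      also have "card (A \<inter> B ?v) \<le> card (A \<inter> C)"
        using AC(3) fin(1)[OF AF(1)] by (intro card_mono) auto
      finally show False using Suc.prems(5)[OF AF AC(4)] by simp
    qed
    then have "|topped s F w| \<le>o |?T|" using inE(2) card_of_ordLeq by blast
    then show ?thesis using S(3) ordLeq_ordLess_trans by blast
  qed
  ultimately show ?case by blast
qed

text \<open>Finite members make the union of \<open>F\<close> no larger than \<open>|Q j|\<close>,
  so \<open>exists_order\<close> applies to it; the greedy colouring then uses colours from
  \<open>Q 0\<close>. Started at different places of the chain \<open>K\<close>, this yields both
  upper bounds.\<close>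

lemma chiCF_le_of_chain:
  fixes Q :: "nat \<Rightarrow> 'a set" and F :: "'a set set"
  assumes inf: "\<And>m. m \<le> j \<Longrightarrow> infinite (Q m)"
    and succ: "\<And>m. m < j \<Longrightarrow> |Q (Suc m)| \<le>o cardSuc |Q m|"
    and t: "Suc j * k < t"
    and sys: "is_system F (Q j) t (k + 1)"
  shows "chiCF_le F (Q 0)"
proof -
  have fin: "\<And>A. A \<in> F \<Longrightarrow> finite A" "\<And>A. A \<in> F \<Longrightarrow> card A = t"
    and ad: "\<And>A B. A \<in> F \<Longrightarrow> B \<in> F \<Longrightarrow> A \<noteq> B \<Longrightarrow> card (A \<inter> B) \<le> k"
    and F: "|F| \<le>o |Q j|"
    using sys ordIso_iff_ordLeq unfolding is_system_def by (auto simp: less_Suc_eq_le)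
  have Qj: "infinite (Q j)" using inf by simp
  have "|\<Union>A\<in>F. A| \<le>o |Q j|"
    using ordLess_imp_ordLeq[OF finite_ordLess_infinite_card[OF fin(1) Qj]]
    by (intro card_of_UNION_ordLeq_infinite[OF Qj F]) blast
  then have "\<exists>s. wf s \<and> (\<forall>A\<in>F. \<exists>v. A \<in> topped s F v) \<and> (\<forall>v. |topped s F v| <o |Q 0| )"
    using fin t by (intro exists_order[of j Q "\<Union>F" F k] inf succ ad) auto
  then obtain s where s: "wf s" "\<forall>A\<in>F. \<exists>v. A \<in> topped s F v" "\<forall>v. |topped s F v| <o |Q 0|"
    by blast
  obtain f where f: "range f \<subseteq> Q 0" "\<forall>A\<in>F. \<exists>v\<in>A. \<forall>u\<in>A - {v}. f u \<noteq> f v"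
    using coloring_of_topped[OF s(1) inf[of 0] fin(1), of F] s(2,3) by auto
  have "\<exists>z\<in>Q 0. card (A \<inter> f -` {z}) = 1" if A: "A \<in> F" for A
  proof -
    obtain v where "v \<in> A" "\<forall>u\<in>A - {v}. f u \<noteq> f v" using f(2) A by blast
    then have "A \<inter> f -` {f v} = {v}" by auto
    then show ?thesis using f(1) by (intro bexI[of _ "f v"]) auto
  qed
  then have "cf_coloring F f (Q 0)" using f(1) unfolding cf_coloring_def by blast
  then show ?thesis
    unfolding chiCF_le_def by (intro exI[of _ f] exI[of _ "Q 0"] conjI card_of_mono1 order_refl)
qed

section \<open>Transfer of set families to systems on the ground type\<close>

text \<open>No conflict free colouring by \<open>R\<close>, in the form that every colour on some member is repeated
  there. Only total colourings are considered; with \<open>R\<close> nonempty this is no restriction.\<close>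
definition no_cf :: "'v set set \<Rightarrow> 'c set \<Rightarrow> bool" where
  "no_cf G R \<longleftrightarrow> (\<forall>f. range f \<subseteq> R \<longrightarrow> (\<exists>A\<in>G. \<forall>v\<in>A. \<exists>u\<in>A. u \<noteq> v \<and> f u = f v))"

text \<open>\<open>h\<close> moves the vertices of \<open>G\<close> into \<open>K\<close>, beside a
  disjoint copy of \<open>K \<times> {..<t}\<close> cut into \<open>|K|\<close> pairwise disjoint
  members. These raise the number of members to \<open>|K|\<close>, and a conflict free colouring of
  the enlarged family would give one of \<open>G\<close>.\<close>

lemma pad_system:
  fixes G :: "'v set set" and K :: "'a set" and R :: "'c set"
  assumes K: "infinite K" and G: "|\<Union>G| \<le>o |K|"
    and unif: "\<And>A. A \<in> G \<Longrightarrow> finite A \<and> card A = t" and t: "2 \<le> t"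
    and ad: "\<And>A B. A \<in> G \<Longrightarrow> B \<in> G \<Longrightarrow> A \<noteq> B \<Longrightarrow> card (A \<inter> B) \<le> k"
    and no: "no_cf G R"
  shows "\<exists>F :: 'a set set. is_system F K t (k + 1) \<and> \<not> chiCF_le F R"
proof -
  have "|K \<times> {..<t}| \<le>o |K|"
    by (intro card_of_Times_ordLeq[OF K] card_of_mono1 order_refl ordLess_imp_ordLeq
        finite_ordLess_infinite_card[OF _ K]) auto
  then have "|\<Union>G <+> K \<times> {..<t}| \<le>o |K|"
    using card_of_Plus_ordLeq_infinite_Field[of "|K|" "\<Union>G" "K \<times> {..<t}"] K G
    by (simp add: Field_card_of card_of_card_order_on)
  then obtain h where h: "inj_on h (\<Union>G <+> K \<times> {..<t})" "h ` (\<Union>G <+> K \<times> {..<t}) \<subseteq> K"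
    unfolding card_of_ordLeq[symmetric] by blast
  define old where "old A = h ` Inl ` A" for A
  define new where "new y = h ` Inr ` ({y} \<times> {..<t})" for y
  define F where "F = old ` G \<union> new ` K"
  have inl: "inj_on (\<lambda>x. h (Inl x)) (\<Union>G)"
    using h(1) by (auto simp: inj_on_def)
  have inr: "inj_on (\<lambda>x. h (Inr x)) (K \<times> {..<t})"
    using h(1) by (auto simp: inj_on_def)
  have old_eq: "old A = (\<lambda>x. h (Inl x)) ` A" and new_eq: "new y = (\<lambda>x. h (Inr x)) ` ({y} \<times> {..<t})" for A y
    unfolding old_def new_def by (auto simp: image_image)
  have card_old: "finite (old A)" "card (old A) = t" if "A \<in> G" for A
    using that unif[OF that] unfolding old_eq
    by (auto intro!: card_image[THEN trans] inj_on_subset[OF inl])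
  have card_new: "finite (new y)" "card (new y) = t" if "y \<in> K" for y
    using that unfolding new_eq by (auto intro!: card_image[THEN trans] inj_on_subset[OF inr])
  have old_new: "old A \<inter> new y = {}" if "A \<in> G" "y \<in> K" for A y
    using that h(1) unfolding old_eq new_eq by (fastforce simp: inj_on_def)
  have new_new: "new y \<inter> new z = {}" if "y \<in> K" "z \<in> K" "y \<noteq> z" for y z
    using that inr unfolding new_eq by (fastforce simp: inj_on_def)
  have old_old: "card (old A \<inter> old B) \<le> k" if "A \<in> G" "B \<in> G" "A \<noteq> B" for A B
  proof -
    have "old A \<inter> old B = (\<lambda>x. h (Inl x)) ` (A \<inter> B)"
      unfolding old_eq using that by (intro inj_on_image_Int[OF inl, symmetric]) auto
    then show ?thesis
      using ad[OF that] card_image_le[of "A \<inter> B" "\<lambda>x. h (Inl x)"] unif[OF that(1)] by simp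
  qed
  have "card (A \<inter> B) \<le> k" if "A \<in> F" "B \<in> F" "A \<noteq> B" for A B
  proof -
    consider a b where "A = old a" "a \<in> G" "B = old b" "b \<in> G"
      | a y where "A = old a" "a \<in> G" "B = new y" "y \<in> K"
      | a y where "B = old a" "a \<in> G" "A = new y" "y \<in> K"
      | y z where "A = new y" "y \<in> K" "B = new z" "z \<in> K"
      using \<open>A \<in> F\<close> \<open>B \<in> F\<close> unfolding F_def by blast
    then show ?thesis
    proof cases
      case 1
      then show ?thesis using old_old[of a b] \<open>A \<noteq> B\<close> by auto
    next
      case 2
      then show ?thesis using old_new[of a y] by simp
    next
      case 3
      then show ?thesis using old_new[of a y] by (simp add: Int_commute)
    next
      case 4
      then have "y \<noteq> z" using \<open>A \<noteq> B\<close> by blast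
      then show ?thesis using 4 new_new[of y z] by simp
    qed
  qed
  moreover have "finite A \<and> card A = t" if "A \<in> F" for A
    using that card_old card_new unfolding F_def by auto
  moreover have "|F| =o |K|"
  proof -
    have "G \<subseteq> Fpow (\<Union>G)" using unif unfolding Fpow_def by auto
    then have "|G| \<le>o |K|"
      by (rule card_of_subset_ordLeq[OF _ card_of_Fpow_ordLeq_infinite[OF K G]])
    then have "|F| \<le>o |K|"
      unfolding F_def by (intro card_of_Un_ordLeq[OF K] card_of_image_ordLeq card_of_mono1 order_refl)
    moreover have "inj_on new K"
    proof (rule inj_onI, rule ccontr)
      fix y z assume "y \<in> K" "z \<in> K" "new y = new z" "y \<noteq> z"
      then show False using new_new[of y z] card_new(2)[of y] t by auto
    qed
    then have "|K| \<le>o |F|" using card_of_ordLeq[of K F] unfolding F_def by blast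
    ultimately show ?thesis using ordIso_iff_ordLeq by blast
  qed
  ultimately have "is_system F K t (k + 1)"
    using t unfolding is_system_def by (auto simp: less_Suc_eq_le)
  moreover have "\<not> chiCF_le F R"
  proof
    assume "chiCF_le F R"
    then obtain f :: "'a \<Rightarrow> 'a" and C where f: "cf_coloring F f C" "|C| \<le>o |R|"
      unfolding chiCF_le_def by blast
    obtain e where e: "inj_on e C" "e ` C \<subseteq> R"
      using f(2) unfolding card_of_ordLeq[symmetric] by blast
    \<comment> \<open>\<open>no_cf\<close> speaks of total colourings, so vertices outside
      \<open>\<Union>G\<close> need a default colour; the member \<open>new y\<close> shows that
      \<open>C\<close> has one.\<close>
    obtain y where "y \<in> K" using K by fastforce
    then obtain c where c: "c \<in> C"
      using f(1) unfolding cf_coloring_def F_def by blast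
    define f' where "f' v = e (if v \<in> \<Union>G then f (h (Inl v)) else c)" for v
    have inC: "f (h (Inl v)) \<in> C" if "v \<in> \<Union>G" for v
      using that f(1) unfolding cf_coloring_def F_def old_eq by blast
    then have "range f' \<subseteq> R" using e(2) c unfolding f'_def by auto
    then obtain A where A: "A \<in> G" "\<forall>v\<in>A. \<exists>u\<in>A. u \<noteq> v \<and> f' u = f' v"
      using no unfolding no_cf_def by blast
    then have "old A \<in> F" unfolding F_def by blast
    then obtain z where "card (old A \<inter> f -` {z}) = 1" using f(1) unfolding cf_coloring_def by blast
    then obtain w where w: "old A \<inter> f -` {z} = {w}" using card_1_singletonE by blast
    then obtain v where v: "v \<in> A" "w = h (Inl v)" unfolding old_eq by blast
    then obtain u where u: "u \<in> A" "u \<noteq> v" "f' u = f' v" using A(2) by blast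
    have uv: "u \<in> \<Union>G" "v \<in> \<Union>G" using u v A(1) by auto
    then have "f (h (Inl u)) = f (h (Inl v))"
      using u(3) inC e(1) unfolding f'_def by (auto simp: inj_on_def)
    then have "h (Inl u) \<in> old A \<inter> f -` {z}" using w v u(1) unfolding old_eq by blast
    then show False using w v(2) u(2) uv inl by (auto simp: inj_on_def)
  qed
  ultimately show ?thesis by blast
qed

lemma chiCF_le_mono: "chiCF_le F R \<Longrightarrow> |R| \<le>o |R'| \<Longrightarrow> chiCF_le F R'"
  unfolding chiCF_le_def using ordLeq_transitive by blast

section \<open>Facet families from partition relations\<close>

text \<open>The partition relation \<open>X \<longrightarrow> (m)\<^sup>i\<^sub>R\<close>.\<close>
definition arrows :: "'x set \<Rightarrow> nat \<Rightarrow> nat \<Rightarrow> 'c set \<Rightarrow> bool" where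
  "arrows X m i R \<longleftrightarrow>
     (\<forall>g. range g \<subseteq> R \<longrightarrow> (\<exists>S\<in>nsets X m. \<exists>c. \<forall>x\<in>nsets S i. g x = c))"

lemma arrows_mono:
  assumes X: "arrows X m i R" and R: "|R'| \<le>o |R|"
  shows "arrows X m i R'"
  unfolding arrows_def
proof (intro allI impI)
  fix g :: "'a set \<Rightarrow> 'c" assume g: "range g \<subseteq> R'"
  obtain e where e: "inj_on e R'" "e ` R' \<subseteq> R"
    using R unfolding card_of_ordLeq[symmetric] by blast
  have "range (\<lambda>x. e (g x)) \<subseteq> R" using g e(2) by auto
  then obtain S c where S: "S \<in> nsets X m" "\<forall>x\<in>nsets S i. e (g x) = c"
    using X unfolding arrows_def by blast
  have "g x = inv_into R' e c" if "x \<in> nsets S i" for x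
  proof -
    have "g x \<in> R'" using g by blast
    then show ?thesis using S(2) that e(1) by (metis inv_into_f_f)
  qed
  then show "\<exists>S\<in>nsets X m. \<exists>c. \<forall>x\<in>nsets S i. g x = c" using S(1) by blast
qed

text \<open>The vertex set \<open>S\<close> of a simplex yields \<open>k\<close> copies of each facet, except that the facet opposite
  to one chosen vertex has only \<open>q\<close> copies.\<close>
definition facets :: "nat \<Rightarrow> nat \<Rightarrow> 'x set \<Rightarrow> ('x set \<times> nat) set" where
  "facets k q S = {(S - {a}, p) | a p. a \<in> S \<and> p < k \<and> (p < q \<or> a \<noteq> (SOME d. d \<in> S))}"

lemma facets_card:
  assumes S: "finite S" "card S = Suc i" and q: "q \<le> k"
  shows "finite (facets k q S) \<and> card (facets k q S) = i * k + q"
proof -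
  define d where "d = (SOME d. d \<in> S)"
  have d: "d \<in> S" using S(2) unfolding d_def by (metis card.empty nat.distinct(1) some_in_eq)
  let ?P = "(S - {d}) \<times> {..<k} \<union> {d} \<times> {..<q}"
  have "facets k q S = (\<lambda>(a, p). (S - {a}, p)) ` ?P"
    using q d unfolding facets_def d_def[symmetric] by (auto simp: image_iff)
  moreover have "inj_on (\<lambda>(a, p). (S - {a}, p)) ?P"
    using d by (auto simp: inj_on_def)
  moreover have "card ?P = i * k + q"
    using S d by (subst card_Un_disjoint) (auto simp: card_cartesian_product)
  ultimately show ?thesis using S(1) by (auto simp: card_image)
qed

lemma facets_Int:
  assumes S: "S \<in> nsets X (Suc i)" "T \<in> nsets X (Suc i)" "S \<noteq> T"
  shows "card (facets k q S \<inter> facets k q T) \<le> k"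
proof -
  have fin: "finite S" "finite T" "card S = Suc i" "card T = Suc i"
    using S unfolding nsets_def by auto
  have "card (S \<inter> T) < Suc i"
    using S(3) fin by (metis Int_lower1 Int_lower2 card_seteq not_less)
  have "facets k q S \<inter> facets k q T \<subseteq> {S \<inter> T} \<times> {..<k}"
  proof
    fix v assume "v \<in> facets k q S \<inter> facets k q T"
    then obtain a b p where v: "v = (S - {a}, p)" "a \<in> S" "p < k" "b \<in> T" "S - {a} = T - {b}"
      unfolding facets_def by blast
    have "card (S - {a}) = i" using fin v by simp
    then have "S - {a} = S \<inter> T"
      using v fin \<open>card (S \<inter> T) < Suc i\<close> by (intro card_seteq) auto
    then show "v \<in> {S \<inter> T} \<times> {..<k}" using v by auto
  qed
  then have "card (facets k q S \<inter> facets k q T) \<le> card ({S \<inter> T} \<times> {..<k})"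
    by (intro card_mono) auto
  then show ?thesis by (simp add: card_cartesian_product)
qed

text \<open>Colour an \<open>i\<close>-set by the list of the colours of its \<open>k\<close>
  copies. On a homogeneous \<open>S\<close> the colour of a vertex depends only on its copy number,
  so it is repeated as soon as a second facet has that copy.\<close>

lemma no_cf_facets:
  assumes arr: "arrows X (Suc i) i {xs. set xs \<subseteq> R \<and> length xs = k}"
    and q: "1 \<le> q" "q \<le> k" and i: "1 \<le> i" "q = k \<or> 2 \<le> i"
  shows "no_cf (facets k q ` nsets X (Suc i)) R"
  unfolding no_cf_def
proof (intro allI impI)
  fix f :: "'a set \<times> nat \<Rightarrow> 'b" assume f: "range f \<subseteq> R"
  have "range (\<lambda>x. map (\<lambda>p. f (x, p)) [0..<k]) \<subseteq> {xs. set xs \<subseteq> R \<and> length xs = k}"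
    using f by (auto dest: range_subsetD)
  then obtain S c where S: "S \<in> nsets X (Suc i)"
      and c: "\<forall>x\<in>nsets S i. map (\<lambda>p. f (x, p)) [0..<k] = c"
    using arr unfolding arrows_def by blast
  have Sf: "finite S" "card S = Suc i" using S unfolding nsets_def by auto
  have f_eq: "f (S - {a}, p) = c ! p" if "a \<in> S" "p < k" for a p
  proof -
    have "S - {a} \<in> nsets S i" using that Sf unfolding nsets_def by auto
    then show ?thesis using c that by (auto dest!: bspec)
  qed
  have "\<exists>u\<in>facets k q S. u \<noteq> v \<and> f u = f v" if v_in: "v \<in> facets k q S" for v
  proof -
    let ?d = "SOME d. d \<in> S"
    obtain a p where v: "v = (S - {a}, p)" "a \<in> S" "p < k" "p < q \<or> a \<noteq> ?d"
      using v_in unfolding facets_def by blast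
    \<comment> \<open>A copy \<open>p < q\<close> exists for every facet. For
      \<open>p \<ge> q\<close> the second facet must not be the exceptional one either, which takes
      three points of \<open>S\<close>; then \<open>q < k\<close>, so \<open>i \<ge> 2\<close>
      provides them.\<close>
    have "\<exists>b\<in>S. b \<noteq> a \<and> (p < q \<or> b \<noteq> ?d)"
    proof (cases "p < q")
      case True
      have "S - {a} \<noteq> {}" using Sf i v by (metis card.empty card_Diff_singleton diff_Suc_1 not_one_le_zero)
      then show ?thesis using True by blast
    next
      case False
      then have "2 \<le> i" using i v by auto
      then have "\<not> S \<subseteq> {a, ?d}"
        using Sf card_mono[of "{a, ?d}" S] card_insert_le_m1[of 2 "{?d}" a] by auto
      then show ?thesis by auto
    qed
    then obtain b where b: "b \<in> S" "b \<noteq> a" "p < q \<or> b \<noteq> ?d" by blast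
    then have "(S - {b}, p) \<in> facets k q S" using v unfolding facets_def by blast
    moreover have "(S - {b}, p) \<noteq> v" using b v by auto
    ultimately show ?thesis using f_eq b v by (intro bexI[of _ "(S - {b}, p)"]) auto
  qed
  then show "\<exists>A\<in>facets k q ` nsets X (Suc i). \<forall>v\<in>A. \<exists>u\<in>A. u \<noteq> v \<and> f u = f v"
    using S by blast
qed

lemma facets_system:
  fixes K :: "'a set" and X :: "'x set" and R :: "'c set"
  assumes K: "infinite K" "|X| \<le>o |K|"
    and arr: "arrows X (Suc i) i {xs. set xs \<subseteq> R \<and> length xs = k}"
    and q: "1 \<le> q" "q \<le> k" and i: "1 \<le> i" "q = k \<or> 2 \<le> i" and t: "t = i * k + q"
  shows "\<exists>F :: 'a set set. is_system F K t (k + 1) \<and> \<not> chiCF_le F R"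
proof (rule pad_system[OF K(1), of "facets k q ` nsets X (Suc i)"])
  have "\<Union>(facets k q ` nsets X (Suc i)) \<subseteq> Fpow X \<times> UNIV"
    unfolding facets_def nsets_def Fpow_def by auto
  moreover have "|Fpow X \<times> (UNIV :: nat set)| \<le>o |K|"
    using K(1) by (intro card_of_Times_ordLeq card_of_Fpow_ordLeq_infinite K)
      (simp add: infinite_iff_card_of_nat)
  ultimately show "|\<Union>(facets k q ` nsets X (Suc i))| \<le>o |K|"
    by (rule card_of_subset_ordLeq)
  show "finite A \<and> card A = t" if "A \<in> facets k q ` nsets X (Suc i)" for A
    using that facets_card[of _ i q k] q t unfolding nsets_def by auto
  have "1 \<le> i * k" using q i by (cases "i * k") auto
  then show "2 \<le> t" using q t by linarith
  show "card (A \<inter> B) \<le> k"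
    if "A \<in> facets k q ` nsets X (Suc i)" "B \<in> facets k q ` nsets X (Suc i)" "A \<noteq> B" for A B
    using that facets_Int[of _ X i _ k q] by blast
  show "no_cf (facets k q ` nsets X (Suc i)) R" by (rule no_cf_facets[OF arr q i])
qed

text \<open>A system with intersections of size at most 1 serves every \<open>k \<ge> 1\<close>. So
  the facet family is taken with one copy per facet and \<open>i = t - 1\<close>, and Ramsey's
  theorem on the naturals supplies the homogeneous set.\<close>

lemma finite_colors_system:
  fixes K :: "'a set" and R :: "'c set"
  assumes K: "infinite K" and R: "finite R" and k: "1 \<le> k" and t: "2 \<le> t"
  shows "\<exists>F :: 'a set set. is_system F K t (k + 1) \<and> \<not> chiCF_le F R"
proof -
  let ?C = "{xs. set xs \<subseteq> R \<and> length xs = 1}"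
  have "finite ?C" using R by (rule finite_lists_length_eq)
  then obtain e :: "'c list \<Rightarrow> nat" where e: "bij_betw e ?C {..<card ?C}"
    using ex_bij_betw_finite_nat[of ?C] by (auto simp: atLeast0LessThan)
  have "arrows (UNIV :: nat set) t (t - 1) {..<card ?C}"
    unfolding arrows_def
  proof (intro allI impI)
    fix g :: "nat set \<Rightarrow> nat" assume "range g \<subseteq> {..<card ?C}"
    then have "g ` nsets UNIV (t - 1) \<subseteq> {..<card ?C}" by blast
    then obtain Y c where Y: "infinite Y" "g ` nsets Y (t - 1) \<subseteq> {c}"
      using Ramsey_nsets[of "UNIV :: nat set" g "t - 1" "card ?C"] by (metis infinite_UNIV_nat)
    obtain S where "S \<subseteq> Y" "finite S" "card S = t" using infinite_arbitrarily_large[OF Y(1)] by blast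
    moreover from this have "\<forall>x\<in>nsets S (t - 1). g x = c"
      using Y(2) nsets_mono[of S Y "t - 1"] by blast
    ultimately show "\<exists>S\<in>nsets UNIV t. \<exists>c. \<forall>x\<in>nsets S (t - 1). g x = c"
      unfolding nsets_def by blast
  qed
  moreover have "|?C| \<le>o |{..<card ?C}|"
    using e unfolding card_of_ordLeq[symmetric] bij_betw_def by blast
  ultimately have "arrows (UNIV :: nat set) t (t - 1) ?C" by (rule arrows_mono)
  moreover have "Suc (t - 1) = t" using t by simp
  ultimately have "\<exists>F :: 'a set set. is_system F K t (1 + 1) \<and> \<not> chiCF_le F R"
    using K t by (intro facets_system[where i = "t - 1" and q = 1 and X = UNIV])
      (auto simp: infinite_iff_card_of_nat)
  then show ?thesis using k unfolding is_system_def by fastforce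
qed

section \<open>The Erdos-Rado theorem under GCH\<close>

lemma large_fibre:
  assumes R: "infinite R" and X: "|R| <o |X|" and f: "f ` X \<subseteq> R"
  shows "\<exists>c\<in>R. |R| <o |{x \<in> X. f x = c}|"
proof (rule ccontr)
  assume "\<not> ?thesis"
  then have "\<forall>c\<in>R. |{x \<in> X. f x = c}| \<le>o |R|" using card_of_not_ordLess by blast
  then have "|\<Union>c\<in>R. {x \<in> X. f x = c}| \<le>o |R|"
    by (intro card_of_UNION_ordLeq_infinite[OF R card_of_mono1[OF order_refl]])
  moreover have "X \<subseteq> (\<Union>c\<in>R. {x \<in> X. f x = c})" using f by auto
  ultimately have "|X| \<le>o |R|" using card_of_subset_ordLeq by blast
  then show False using X not_ordLess_ordLeq by blast
qed

lemma infinite_of_Pow: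
  assumes "infinite D" "|Pow D| \<le>o |M|"
  shows "infinite M"
  using ordLess_ordLeq_trans[OF card_of_Pow assms(2)] assms(1) card_of_ordLeq_finite ordLess_imp_ordLeq
  by blast

lemma card_of_underS_cardSuc:
  assumes "|M| \<le>o cardSuc |D|" "\<xi> \<in> M"
  shows "|underS (card_of M) \<xi>| \<le>o |D|"
proof -
  have "|underS (card_of M) \<xi>| <o |M|"
    using assms(2) by (intro card_of_underS card_of_Card_order) (simp add: Field_card_of)
  then have "|underS (card_of M) \<xi>| <o cardSuc |D|" by (rule ordLess_ordLeq_trans[OF _ assms(1)])
  then show ?thesis using cardSuc_ordLeq_ordLess[OF card_of_Card_order card_of_Card_order] by blast
qed

lemma card_of_Pow_ordLeq: "|A| \<le>o |B| \<Longrightarrow> |Pow A| \<le>o |Pow B|"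
proof -
  assume "|A| \<le>o |B|"
  then obtain e where "inj_on e A" "e ` A \<subseteq> B" unfolding card_of_ordLeq[symmetric] by blast
  then have "inj_on (image e) (Pow A)" "image e ` Pow A \<subseteq> Pow B"
    by (auto simp: inj_on_image_Pow)
  then show ?thesis unfolding card_of_ordLeq[symmetric] by blast
qed

lemma underS_trans: "\<eta> \<in> underS (card_of M) \<xi> \<Longrightarrow> underS (card_of M) \<eta> \<subseteq> underS (card_of M) \<xi>"
  using card_of_well_order_on[of M]
  unfolding underS_def order_on_defs by (auto dest: transD antisymD)

text \<open>Below \<open>b\<close> build a sequence \<open>h\<close> whose terms realize the type of \<open>b\<close> over the earlier terms. If every
  \<open>b\<close> occurred in its own sequence, say as \<open>h b (\<xi> b) = b\<close>, then \<open>b\<close> could be recovered from \<open>\<xi> b\<close> and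
  its type, and there are only \<open>|M|\<close> of these.\<close>
lemma end_homogeneous:
  fixes f :: "'x set \<Rightarrow> 'c" and M :: "'m set" and D :: "'d set"
  assumes D: "infinite D" and R: "|R| \<le>o |D|" and f: "range f \<subseteq> R"
    and M: "|M| \<le>o cardSuc |D|" "|Pow D| \<le>o |M|" and X: "|M| <o |X|"
  shows "\<exists>b\<in>X. \<exists>h. inj_on h M \<and> h ` M \<subseteq> X \<and>
    (\<forall>\<xi>\<in>M. \<forall>e\<in>Fpow (underS (card_of M) \<xi>). f (insert (h \<xi>) (h ` e)) = f (insert b (h ` e)))"
proof -
  define s where "s = |M| - Id"
  have wf: "wf s" using card_of_well_order_on[of M] unfolding s_def by (simp add: well_order_on_def)
  have pred: "underS (card_of M) \<xi> = {\<eta>. (\<eta>, \<xi>) \<in> s}" for \<xi> unfolding underS_def s_def by auto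
  \<comment> \<open>A good \<open>c\<close> is a new point that has the same type as
    \<open>b\<close> over \<open>B\<close>: colours of finite sets whose other points lie in
    \<open>B\<close> do not distinguish them.\<close>
  define good where
    "good B b c \<longleftrightarrow> c \<in> X - B \<and> (\<forall>x\<in>Fpow B. f (insert c x) = f (insert b x))" for B b c
  define h where "h b = wfrec s (\<lambda>h \<xi>. SOME c. good (h ` underS (card_of M) \<xi>) b c)" for b
  have h: "h b \<xi> = (SOME c. good (h b ` underS (card_of M) \<xi>) b c)" for b \<xi>
  proof -
    have "cut (h b) s \<xi> ` underS (card_of M) \<xi> = h b ` underS (card_of M) \<xi>"
      unfolding pred by (auto simp: cut_def image_def)
    then show ?thesis using def_wfrec[OF h_def[THEN eq_reflection] wf, of b \<xi>] by simp
  qed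
  have "\<exists>b\<in>X. b \<notin> h b ` M"
  proof (rule ccontr)
    assume "\<not> ?thesis"
    then have "\<forall>b\<in>X. \<exists>\<xi>. \<xi> \<in> M \<and> h b \<xi> = b" by (metis imageE)
    then obtain \<xi> where \<xi>: "\<And>b. b \<in> X \<Longrightarrow> \<xi> b \<in> M" "\<And>b. b \<in> X \<Longrightarrow> h b (\<xi> b) = b" by metis
    \<comment> \<open>The type is indexed by positions rather than by terms, so that codes of
      different points can be compared before their sequences are known to agree.\<close>
    define \<Phi> where
      "\<Phi> b = (\<xi> b, (\<lambda>e. (e, f (insert b (h b ` e)))) ` Fpow (underS (card_of M) (\<xi> b)))" for b
    have "inj_on \<Phi> X"
    proof (rule inj_onI)
      fix b b' assume b: "b \<in> X" "b' \<in> X" "\<Phi> b = \<Phi> b'"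
      have \<xi>_eq: "\<xi> b' = \<xi> b" using b(3) unfolding \<Phi>_def by simp
      have type_eq: "f (insert b (h b ` e)) = f (insert b' (h b' ` e))"
        if "e \<in> Fpow (underS (card_of M) (\<xi> b))" for e
      proof -
        have "(e, f (insert b (h b ` e))) \<in> snd (\<Phi> b')"
          unfolding b(3)[symmetric] using that unfolding \<Phi>_def by auto
        then show ?thesis unfolding \<Phi>_def by auto
      qed
      \<comment> \<open>Equal codes force the two sequences to agree up to and including position
        \<open>\<xi> b\<close>, where their values are \<open>b\<close> and
        \<open>b'\<close>.\<close>
      have "\<eta> \<in> insert (\<xi> b) (underS (card_of M) (\<xi> b)) \<longrightarrow> h b \<eta> = h b' \<eta>" for \<eta>
      proof (induction \<eta> rule: wf_induct_rule[OF wf])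
        case (1 \<eta>)
        show ?case
        proof
          assume \<eta>: "\<eta> \<in> insert (\<xi> b) (underS (card_of M) (\<xi> b))"
          then have sub: "underS (card_of M) \<eta> \<subseteq> underS (card_of M) (\<xi> b)"
            using underS_trans[of \<eta> M "\<xi> b"] by auto
          have eq: "h b \<zeta> = h b' \<zeta>" if "\<zeta> \<in> underS (card_of M) \<eta>" for \<zeta>
            using 1[of \<zeta>] that sub by (auto simp: pred)
          then have im: "h b ` e = h b' ` e" if "e \<subseteq> underS (card_of M) \<eta>" for e
            using that by (intro image_cong) auto
          have "f (insert b x) = f (insert b' x)" if x: "x \<in> Fpow (h b ` underS (card_of M) \<eta>)" for x
          proof -
            obtain e where e: "e \<subseteq> underS (card_of M) \<eta>" "finite e" "x = h b ` e"
              using x finite_subset_image[of x "h b"] unfolding Fpow_def by blast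
            then show ?thesis using type_eq[of e] im[of e] sub unfolding Fpow_def by auto
          qed
          then have "good (h b ` underS (card_of M) \<eta>) b = good (h b' ` underS (card_of M) \<eta>) b'"
            using im[of "underS (card_of M) \<eta>"] unfolding good_def by auto
          then show "h b \<eta> = h b' \<eta>" unfolding h[of b \<eta>] h[of b' \<eta>] by simp
        qed
      qed
      then show "b = b'" using \<xi>(2)[OF b(1)] \<xi>(2)[OF b(2)] \<xi>_eq by auto
    qed
    moreover have "\<Phi> ` X \<subseteq> (SIGMA x:M. Pow (Fpow (underS (card_of M) x) \<times> R))"
      using \<xi>(1) f unfolding \<Phi>_def by auto
    moreover have "|SIGMA x:M. Pow (Fpow (underS (card_of M) x) \<times> R)| \<le>o |M|"
    proof (rule card_of_Sigma_ordLeq_infinite[OF infinite_of_Pow[OF D M(2)] card_of_mono1[OF order_refl]])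
      show "\<forall>x\<in>M. |Pow (Fpow (underS (card_of M) x) \<times> R)| \<le>o |M|"
        by (intro ballI ordLeq_transitive[OF card_of_Pow_ordLeq M(2)] card_of_Times_ordLeq
            card_of_Fpow_ordLeq_infinite card_of_underS_cardSuc D R M(1))
    qed
    ultimately have "|X| \<le>o |M|"
      using card_of_ordLeq[THEN iffD1] ordLeq_transitive by blast
    then show False using X not_ordLess_ordLeq by blast
  qed
  then obtain b where b: "b \<in> X" "b \<notin> h b ` M" by blast
  \<comment> \<open>As \<open>b\<close> is missing from its own sequence, \<open>b\<close> itself is
    a candidate at every position, so each \<open>SOME\<close> of the recursion has a
    witness.\<close>
  have good: "good (h b ` underS (card_of M) \<xi>) b (h b \<xi>)" if "\<xi> \<in> M" for \<xi>
  proof -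
    have "underS (card_of M) \<xi> \<subseteq> M" using Field_card_of[of M] unfolding underS_def Field_def by auto
    then have "good (h b ` underS (card_of M) \<xi>) b b" using b unfolding good_def by auto
    then show ?thesis unfolding h[of b \<xi>] by (rule someI)
  qed
  have "inj_on (h b) M"
  proof (rule inj_onI, rule ccontr)
    fix x y assume xy: "x \<in> M" "y \<in> M" "h b x = h b y" "x \<noteq> y"
    then have "x \<in> underS (card_of M) y \<or> y \<in> underS (card_of M) x"
      using card_of_well_order_on[of M] unfolding underS_def order_on_defs total_on_def by auto
    then show False using xy good[of x] good[of y] unfolding good_def by (auto simp: image_iff)
  qed
  moreover have "h b ` M \<subseteq> X" using good unfolding good_def by auto
  moreover have "f (insert (h b \<xi>) (h b ` e)) = f (insert b (h b ` e))"
    if "\<xi> \<in> M" "e \<in> Fpow (underS (card_of M) \<xi>)" for \<xi> e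
  proof -
    have "h b ` e \<in> Fpow (h b ` underS (card_of M) \<xi>)" using that(2) unfolding Fpow_def by blast
    then show ?thesis using good[OF that(1)] unfolding good_def by blast
  qed
  ultimately show ?thesis using b(1) by blast
qed

text \<open>On the end-homogeneous copy of \<open>M\<close>, replacing the last term of an
  \<open>(i+1)\<close>-set by \<open>b\<close> keeps its colour. Thus \<open>g\<close> is governed
  by a colouring of \<open>i\<close>-sets, to which \<open>arr\<close> applies.\<close>

lemma arrows_step:
  fixes M :: "'m set" and D :: "'d set" and X :: "'x set" and R :: "'c set"
  assumes D: "infinite D" and R: "|R| \<le>o |D|"
    and M: "|M| \<le>o cardSuc |D|" "|Pow D| \<le>o |M|" and X: "|M| <o |X|"
    and arr: "arrows M m i R"
  shows "arrows X m (Suc i) R"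
  unfolding arrows_def
proof (intro allI impI)
  fix g :: "'x set \<Rightarrow> 'c" assume g: "range g \<subseteq> R"
  from end_homogeneous[OF D R g M X] obtain b h
    where bh: "inj_on h M \<and> h ` M \<subseteq> X \<and> (\<forall>\<xi>\<in>M. \<forall>e\<in>Fpow (underS (card_of M) \<xi>).
      g (insert (h \<xi>) (h ` e)) = g (insert b (h ` e)))"
    by (elim bexE exE)
  then have h: "inj_on h M" "h ` M \<subseteq> X" by simp_all
  have "range (\<lambda>e. g (insert b (h ` e))) \<subseteq> R" using g by auto
  from arr[unfolded arrows_def, rule_format, OF this] obtain S c
    where S: "S \<in> nsets M m" and c: "\<forall>e\<in>nsets S i. g (insert b (h ` e)) = c"
    by (elim bexE exE)
  have "h ` S \<in> nsets X m"
    using S h by (auto simp: nsets_def card_image inj_on_subset)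
  moreover have "g x = c" if x: "x \<in> nsets (h ` S) (Suc i)" for x
  proof -
    obtain E where E: "E \<subseteq> S" "finite E" "x = h ` E"
      using x finite_subset_image[of x h S] unfolding nsets_def by blast
    have EM: "E \<subseteq> M" using E S unfolding nsets_def by auto
    have card_E: "card E = Suc i"
      using x E card_image[OF inj_on_subset[OF h(1) EM]] unfolding nsets_def by auto
    then have "E \<noteq> {}" by auto
    then obtain \<xi> where \<xi>: "\<xi> \<in> E" "\<forall>\<eta>\<in>E. (\<eta>, \<xi>) \<in> |M|"
      using finite_has_max_card_of[OF E(2) _ EM] by blast
    have "E - {\<xi>} \<in> Fpow (underS (card_of M) \<xi>)"
      using \<xi> E(2) unfolding Fpow_def underS_def by auto
    then have "g (insert (h \<xi>) (h ` (E - {\<xi>}))) = g (insert b (h ` (E - {\<xi>})))"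
      using bh \<xi>(1) EM by blast
    moreover have "insert (h \<xi>) (h ` (E - {\<xi>})) = x" using \<xi>(1) E(3) by auto
    moreover have "E - {\<xi>} \<in> nsets S i" using E \<xi>(1) card_E unfolding nsets_def by auto
    ultimately show ?thesis using c by simp
  qed
  ultimately show "\<exists>S\<in>nsets X m. \<exists>c. \<forall>x\<in>nsets S (Suc i). g x = c" by blast
qed

lemma arrows_one:
  fixes X :: "'x set" and R :: "'c set"
  assumes R: "infinite R" and X: "|R| <o |X|"
  shows "arrows X m (Suc 0) R"
  unfolding arrows_def
proof (intro allI impI)
  fix g :: "'x set \<Rightarrow> 'c" assume "range g \<subseteq> R"
  then have "(\<lambda>x. g {x}) ` X \<subseteq> R" by auto
  then obtain c where c: "|R| <o |{x \<in> X. g {x} = c}|" using large_fibre[OF R X] by blast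
  then have "infinite {x \<in> X. g {x} = c}"
    using R card_of_ordLeq_finite ordLess_imp_ordLeq by blast
  then obtain S where S: "S \<subseteq> {x \<in> X. g {x} = c}" "finite S" "card S = m"
    using infinite_arbitrarily_large by blast
  then have "\<forall>x\<in>nsets S (Suc 0). g x = c" unfolding nsets_def by (auto simp: card_Suc_eq)
  moreover have "S \<in> nsets X m" using S unfolding nsets_def by auto
  ultimately show "\<exists>S\<in>nsets X m. \<exists>c. \<forall>x\<in>nsets S (Suc 0). g x = c" by blast
qed

lemma GCH_onD:
  fixes A :: "'a set"
  assumes "GCH_on TYPE('a)" "infinite A" "|B| =o cardSuc |A|"
  shows "|Pow A| \<le>o |B|"
  using assms ordIso_symmetric ordIso_transitive ordIso_iff_ordLeq unfolding GCH_on_def by blast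

text \<open>Induction on the exponent from the pigeonhole principle. GCH bounds
  \<open>Pow (Q i)\<close> by \<open>Q (Suc i)\<close>, so one more exponent costs one more
  successor.\<close>

lemma erdos_rado:
  fixes Q :: "nat \<Rightarrow> 'a set"
  assumes gch: "GCH_on TYPE('a)"
    and inf: "\<And>l. l \<le> Suc i \<Longrightarrow> infinite (Q l)"
    and succ: "\<And>l. l < Suc i \<Longrightarrow> |Q (Suc l)| =o cardSuc |Q l|"
  shows "arrows (Q (Suc i)) m (Suc i) (Q 0)"
  using inf succ
proof (induction i)
  case 0
  have "|Q 0| <o |Q (Suc 0)|"
    using ordLess_ordIso_trans[OF cardSuc_greater[OF card_of_Card_order] ordIso_symmetric[OF 0(2)[of 0]]]
    by simp
  then show ?case using 0 by (intro arrows_one) auto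
next
  case (Suc i)
  have less: "|Q l| <o |Q (Suc l)|" if "l \<le> Suc i" for l
    using ordLess_ordIso_trans[OF cardSuc_greater[OF card_of_Card_order] ordIso_symmetric[OF Suc(3)[of l]]]
      that by simp
  have "|Q 0| \<le>o |Q l|" if "l \<le> Suc i" for l
    using that
  proof (induction l)
    case 0
    then show ?case by (simp add: card_of_mono1)
  next
    case (Suc l)
    then show ?case using ordLeq_transitive[OF _ ordLess_imp_ordLeq[OF less[of l]]] by simp
  qed
  moreover have "|Pow (Q i)| \<le>o |Q (Suc i)|"
    using Suc.prems by (intro GCH_onD[OF gch]) simp_all
  moreover have "|Q (Suc i)| \<le>o cardSuc |Q i|"
    using Suc.prems(2)[of i] by (simp add: ordIso_iff_ordLeq)
  moreover have "arrows (Q (Suc i)) m (Suc i) (Q 0)" using Suc.prems by (intro Suc.IH) simp_all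
  ultimately show ?case
    using arrows_step[of "Q i" "Q 0" "Q (Suc i)" "Q (Suc (Suc i))" m "Suc i"]
      Suc.prems(1)[of i] less[of "Suc i"] by simp
qed

section \<open>Almost disjoint families by diagonalization\<close>

text \<open>Choose along the cardinal well-order of \<open>J\<close>: fewer than \<open>|J|\<close>
  values are taken at any stage, and every \<open>A j\<close> has at least \<open>|D|\<close>
  elements.\<close>

lemma distinct_representatives:
  assumes J: "|J| \<le>o |D|" and A: "\<And>j. j \<in> J \<Longrightarrow> |D| \<le>o |A j|"
  shows "\<exists>p. inj_on p J \<and> (\<forall>j\<in>J. p j \<in> A j)"
proof -
  have wf: "wf ( |J| - Id)" using card_of_well_order_on[of J] by (simp add: well_order_on_def)
  have "|underS (card_of J) j| <o |A j|" if "j \<in> J" for j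
  proof -
    have "|underS (card_of J) j| <o |J|"
      using that by (intro card_of_underS card_of_Card_order) (simp add: Field_card_of)
    then show ?thesis by (rule ordLess_ordLeq_trans[OF ordLess_ordLeq_trans[OF _ J] A[OF that]])
  qed
  then obtain p where p: "\<forall>j\<in>J. p j \<in> A j \<and> p j \<notin> p ` underS (card_of J) j"
    using greedy_choice[OF wf, of "underS (card_of J)" J A] unfolding underS_def by blast
  have "inj_on p J"
  proof (rule inj_onI, rule ccontr)
    fix x y assume xy: "x \<in> J" "y \<in> J" "p x = p y" "x \<noteq> y"
    then have "x \<in> underS (card_of J) y \<or> y \<in> underS (card_of J) x"
      using card_of_well_order_on[of J] unfolding underS_def order_on_defs total_on_def by auto
    then show False using xy p by (metis imageI)
  qed
  then show ?thesis using p by blast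
qed

text \<open>Infinite successor cardinals are regular: an unbounded \<open>Y\<close> would be cofinal
  and so have size \<open>|L|\<close>.\<close>

lemma bounded_of_small:
  assumes D: "infinite D" and L: "|L| =o cardSuc |D|" and Y: "Y \<subseteq> L" "|Y| \<le>o |D|"
  shows "\<exists>a\<in>L. Y \<subseteq> under |L| a"
proof (rule ccontr)
  assume neg: "\<not> ?thesis"
  have "Cinfinite |D|"
    using D by (simp add: cinfinite_def Field_card_of card_of_card_order_on)
  then have "regularCard (cardSuc |D| )" "Cinfinite (cardSuc |D| )"
    by (rule regularCard_cardSuc, rule Cinfinite_cardSuc)
  then have reg: "regularCard |L|"
    using regularCard_ordIso[OF ordIso_symmetric[OF L]] by blast
  have "cofinal Y |L|"
    unfolding cofinal_def
  proof
    fix a assume "a \<in> Field |L|"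
    then have a: "a \<in> L" by (simp add: Field_card_of)
    then obtain b where "b \<in> Y" "b \<notin> under |L| a" using neg by blast
    then have "b \<noteq> a" "b \<in> L"
      using a Y(1) card_of_well_order_on[of L] unfolding under_def order_on_defs refl_on_def by auto
    moreover from this have "(a, b) \<in> |L|"
      using a \<open>b \<notin> under |L| a\<close> card_of_well_order_on[of L]
      unfolding under_def order_on_defs total_on_def by blast
    ultimately show "\<exists>b\<in>Y. a \<noteq> b \<and> (a, b) \<in> |L|" using \<open>b \<in> Y\<close> by (intro bexI[of _ b]) auto
  qed
  then have "|Y| =o |L|" using reg Y(1) unfolding regularCard_def by (simp add: Field_card_of)
  then have "|L| \<le>o |D|" using Y(2) ordIso_symmetric ordIso_ordLeq_trans by blast
  then show False
    using ordLess_ordIso_trans[OF cardSuc_greater[OF card_of_Card_order] ordIso_symmetric[OF L]]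
      not_ordLess_ordLeq by blast
qed

text \<open>The case \<open>i = 1\<close>, \<open>t = k + s\<close>. Pigeonhole gives each colouring
  a large homogeneous set of points; to place a member over it and stay almost disjoint, each point
  \<open>b\<close> anticipates all large bounded sets listed before it.\<close>

lemma diagonal_system:
  fixes L :: "'x set" and D :: "'c set"
  assumes D: "infinite D" and L: "|L| =o cardSuc |D|" "|Pow D| \<le>o |L|"
    and s: "1 \<le> s" "s \<le> k"
  shows "\<exists>G :: ('x \<times> nat) set set. \<Union>G \<subseteq> L \<times> UNIV \<and>
    (\<forall>A\<in>G. finite A \<and> card A = k + s) \<and>
    (\<forall>A\<in>G. \<forall>B\<in>G. A \<noteq> B \<longrightarrow> card (A \<inter> B) \<le> k) \<and> no_cf G D"
proof -
  let ?r = "|L|"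
  define q where "q = k - s"
  have DL: "|D| <o |L|"
    by (rule ordLess_ordIso_trans[OF cardSuc_greater[OF card_of_Card_order] ordIso_symmetric[OF L(1)]])
  have Linf: "infinite L" by (rule infinite_of_Pow[OF D L(2)])
  have ord: "refl_on L ?r" "trans ?r" "antisym ?r" "total_on L ?r"
    using card_of_well_order_on[of L] by (auto simp: order_on_defs)
  have rL: "a \<in> L" "b \<in> L" if "(a, b) \<in> ?r" for a b
    using that Field_card_of[of L] unfolding Field_def by auto
  have underS_small: "|underS ?r a| \<le>o |D|" if "a \<in> L" for a
    using card_of_underS_cardSuc[OF _ that] L(1) ordIso_iff_ordLeq by blast
  have under_small: "|under ?r a| \<le>o |D|" if "a \<in> L" for a
  proof -
    have "under ?r a \<subseteq> insert a (underS ?r a)" unfolding under_def underS_def by auto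
    then show ?thesis
      by (rule card_of_subset_ordLeq[OF _ card_of_insert_ordLeq[OF D underS_small[OF that]]])
  qed

  let ?Bd = "\<Union>a\<in>L. Pow (under ?r a)"
  have le: "|?Bd| \<le>o |L|"
    by (intro card_of_UNION_ordLeq_infinite[OF Linf card_of_mono1[OF order_refl]] ballI
        ordLeq_transitive[OF card_of_Pow_ordLeq[OF under_small] L(2)])
  obtain a\<^sub>0 where "a\<^sub>0 \<in> L" using infinite_imp_nonempty[OF Linf] by blast
  then have ne: "?Bd \<noteq> {}" by blast
  from iffD2[OF card_of_ordLeq2[OF ne] le] obtain e where e: "e ` L = ?Bd" by (elim exE)

  \<comment> \<open>\<open>e\<close> enumerates the bounded subsets of \<open>L\<close>; \<open>I b\<close> indexes the large ones listed and bounded below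
    \<open>b\<close>. There are at most \<open>|D|\<close> of these, so distinct representatives can be chosen in them. Each colouring
    of \<open>L \<times> {..<s}\<close> has a constant fibre \<open>?H\<close> of size above \<open>|D|\<close>; a bounded \<open>Y \<subseteq> ?H\<close> of size \<open>|D|\<close> and a
    late \<open>b \<in> ?H\<close> give a member on which every colour repeats.\<close>
  define I where "I b = {x \<in> underS ?r b. e x \<subseteq> underS ?r b \<and> |D| \<le>o |e x| }" for b
  have "\<exists>p. inj_on p (I b \<times> {..q}) \<and> (\<forall>j\<in>I b \<times> {..q}. p j \<in> e (fst j))" if b: "b \<in> L" for b
  proof (rule distinct_representatives)
    have "I b \<subseteq> underS ?r b" unfolding I_def by auto
    then have "|I b| \<le>o |D|" by (rule card_of_subset_ordLeq[OF _ underS_small[OF b]])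
    then show "|I b \<times> {..q}| \<le>o |D|"
      by (rule card_of_Times_ordLeq[OF D _ ordLess_imp_ordLeq[OF finite_ordLess_infinite_card[OF _ D]]]) auto
    show "|D| \<le>o |e (fst j)|" if "j \<in> I b \<times> {..q}" for j using that unfolding I_def by auto
  qed
  then obtain p where p: "\<And>b. b \<in> L \<Longrightarrow> inj_on (p b) (I b \<times> {..q})"
      "\<And>b x l. b \<in> L \<Longrightarrow> x \<in> I b \<Longrightarrow> l \<le> q \<Longrightarrow> p b (x, l) \<in> e x"
    by (metis (no_types, lifting) SigmaI atMost_iff fst_conv)
  have p_below: "p b (x, l) \<in> underS ?r b" if "b \<in> L" "x \<in> I b" "l \<le> q" for b x l
    using p(2)[OF that] that(2) unfolding I_def by auto

  \<comment> \<open>A member has \<open>s + s + q = k + s\<close> vertices: \<open>s\<close> copies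
    of \<open>b\<close>, \<open>s\<close> copies of one lower point to match them in colour, and
    \<open>q\<close> single vertices that match \<open>(b, 0)\<close>.\<close>
  define low where "low b x = {p b (x, 0)} \<times> {..<s} \<union> (\<lambda>l. (p b (x, l), 0)) ` {1..q}" for b x
  define edge where "edge b x = {b} \<times> {..<s} \<union> low b x" for b x
  define G where "G = {edge b x | b x. b \<in> L \<and> x \<in> I b}"
  have low_below: "fst v \<in> underS ?r b" if "b \<in> L" "x \<in> I b" "v \<in> low b x" for b x v
    using that p_below unfolding low_def by auto
  have card_low: "finite (low b x)" "card (low b x) = k" if "b \<in> L" "x \<in> I b" for b x
  proof -
    have inj: "p b (x, l) \<noteq> p b (x, l')" if "l \<le> q" "l' \<le> q" "l \<noteq> l'" for l l'
      using p(1)[OF \<open>b \<in> L\<close>] that \<open>x \<in> I b\<close> by (auto simp: inj_on_def)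
    have "inj_on (\<lambda>l. (p b (x, l), 0::nat)) {1..q}"
    proof (rule inj_onI, rule ccontr)
      fix l l' assume "l \<in> {1..q}" "l' \<in> {1..q}" "(p b (x, l), 0::nat) = (p b (x, l'), 0)" "l \<noteq> l'"
      then show False using inj[of l l'] by simp
    qed
    moreover have "{p b (x, 0)} \<times> {..<s} \<inter> (\<lambda>l. (p b (x, l), 0)) ` {1..q} = {}"
      using inj[of 0] by fastforce
    ultimately have "card (low b x) = s + q"
      unfolding low_def by (subst card_Un_disjoint) (auto simp: card_image card_cartesian_product)
    then show "card (low b x) = k" using s unfolding q_def by simp
    show "finite (low b x)" unfolding low_def by auto
  qed
  have card_edge: "finite (edge b x)" "card (edge b x) = k + s" if "b \<in> L" "x \<in> I b" for b x
  proof -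
    have "{b} \<times> {..<s} \<inter> low b x = {}"
      using low_below[OF that] unfolding underS_def by fastforce
    then show "card (edge b x) = k + s"
      unfolding edge_def using card_low[OF that]
      by (subst card_Un_disjoint) (auto simp: card_cartesian_product)
    show "finite (edge b x)" unfolding edge_def using card_low[OF that] by auto
  qed
  \<comment> \<open>Injectivity of \<open>p b\<close> separates the lower parts, so only the
    \<open>s\<close> copies of \<open>b\<close> are shared.\<close>
  have same_top: "card (edge b x \<inter> edge b y) \<le> k"
    if "b \<in> L" "x \<in> I b" "y \<in> I b" "x \<noteq> y" for b x y
  proof -
    have "fst ` low b x \<subseteq> (\<lambda>l. p b (x, l)) ` {..q}" "fst ` low b y \<subseteq> (\<lambda>l. p b (y, l)) ` {..q}"
      unfolding low_def by auto
    moreover have "(\<lambda>l. p b (x, l)) ` {..q} \<inter> (\<lambda>l. p b (y, l)) ` {..q} = {}"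
      using p(1)[OF that(1)] that by (auto simp: inj_on_def)
    ultimately have "low b x \<inter> low b y = {}" by blast
    moreover have "low b x \<inter> {b} \<times> {..<s} = {}" "low b y \<inter> {b} \<times> {..<s} = {}"
      using low_below[OF that(1,2)] low_below[OF that(1,3)] unfolding underS_def by fastforce+
    ultimately have "edge b x \<inter> edge b y \<subseteq> {b} \<times> {..<s}" unfolding edge_def by blast
    then have "card (edge b x \<inter> edge b y) \<le> card ({b} \<times> {..<s})" by (intro card_mono) auto
    then show ?thesis using s by (simp add: card_cartesian_product)
  qed
  \<comment> \<open>The larger top \<open>b\<close> does not occur in the other member, so the
    intersection lies in the lower part, which has \<open>k\<close> vertices.\<close>
  have diff_top: "card (edge b x \<inter> edge c y) \<le> k"
    if "b \<in> L" "x \<in> I b" "c \<in> L" "y \<in> I c" "b \<noteq> c" "(c, b) \<in> ?r" for b c x y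
  proof -
    have "b \<notin> fst ` edge c y"
    proof
      assume "b \<in> fst ` edge c y"
      then have "(b, c) \<in> ?r"
        using low_below[OF that(3,4)] \<open>b \<noteq> c\<close> unfolding edge_def underS_def by auto
      then show False using that(5,6) ord(3) by (auto dest: antisymD)
    qed
    then have "edge b x \<inter> edge c y \<subseteq> low b x" unfolding edge_def[of b x] by force
    then show ?thesis using card_mono[OF card_low(1)] card_low(2) that(1,2) by metis
  qed
  have ad: "card (A \<inter> B) \<le> k" if AB: "A \<in> G" "B \<in> G" "A \<noteq> B" for A B
  proof -
    obtain b x c y where bx: "A = edge b x" "b \<in> L" "x \<in> I b" and cy: "B = edge c y" "c \<in> L" "y \<in> I c"
      using AB unfolding G_def by blast
    consider "b = c" | "b \<noteq> c" "(c, b) \<in> ?r" | "b \<noteq> c" "(b, c) \<in> ?r"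
      using ord(4) bx cy unfolding total_on_def by blast
    then show ?thesis
    proof cases
      case 1
      then have "x \<noteq> y" using AB(3) bx cy by blast
      then show ?thesis using same_top[of b x y] bx cy 1 by simp
    next
      case 2
      then show ?thesis using diff_top[of b x c y] bx cy by simp
    next
      case 3
      then show ?thesis using diff_top[of c y b x] bx cy by (simp add: Int_commute)
    qed
  qed
  have "no_cf G D"
    unfolding no_cf_def
  proof (intro allI impI)
    fix f :: "'x \<times> nat \<Rightarrow> 'c" assume f: "range f \<subseteq> D"
    define g where "g a = map (\<lambda>i. f (a, i)) [0..<s]" for a
    have lists_D: "|lists D| \<le>o |D|"
      by (rule card_of_lists_ordLeq_infinite[OF D card_of_mono1[OF order_refl]])
    have "D \<subseteq> hd ` lists D" by (auto intro!: image_eqI[of _ hd "[_]"])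
    then have D_lists: "|D| \<le>o |lists D|"
      by (rule card_of_subset_ordLeq[OF _ card_of_image])
    then have lists_inf: "infinite (lists D)" using D by (rule card_of_ordLeq_infinite)
    have g: "g ` L \<subseteq> lists D" using f unfolding g_def by (auto dest: range_subsetD)
    from large_fibre[OF lists_inf ordLeq_ordLess_trans[OF lists_D DL] g]
    obtain c where "|lists D| <o |{a \<in> L. g a = c}|" by (elim bexE)
    then have H: "|D| <o |{a \<in> L. g a = c}|" (is "_ <o |?H|")
      by (rule ordLeq_ordLess_trans[OF D_lists])
    from iffD1[OF internalize_card_of_ordLeq ordLess_imp_ordLeq[OF H]]
    obtain Y where Y: "Y \<subseteq> ?H" "|D| =o |Y|" unfolding Field_card_of by blast
    have "Y \<subseteq> L" using Y(1) by blast
    moreover have "|Y| \<le>o |D|" using Y(2) by (simp add: ordIso_iff_ordLeq)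
    ultimately obtain a where a: "a \<in> L" "Y \<subseteq> under ?r a"
      using bounded_of_small[OF D L(1), of Y] by blast
    then have "Y \<in> e ` L" unfolding e by blast
    then obtain x where x: "x \<in> L" "e x = Y" by blast
    \<comment> \<open>The point \<open>b\<close> must lie beyond the bound \<open>a\<close> of
      \<open>Y\<close> and beyond the index \<open>x\<close> of \<open>Y\<close>, so that
      \<open>x \<in> I b\<close>; \<open>?H\<close> is too large to lie below these two.\<close>
    have "|under ?r a \<union> under ?r x| \<le>o |D|"
      by (intro card_of_Un_ordLeq[OF D] under_small a x)
    then have "\<not> ?H \<subseteq> under ?r a \<union> under ?r x"
      using not_ordLess_ordLeq[OF H] card_of_subset_ordLeq[of ?H "under ?r a \<union> under ?r x" "|D|"] by blast
    then obtain b where b: "b \<in> L" "g b = c" "b \<notin> under ?r a" "b \<notin> under ?r x" by blast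
    have above: "y \<in> underS ?r b" if "y \<in> under ?r z" "b \<notin> under ?r z" "z \<in> L" for y z
    proof -
      have "(z, b) \<in> ?r"
        using that b(1) ord(1,4) unfolding under_def total_on_def refl_on_def by (cases "z = b"; blast)
      then show ?thesis using that ord(2) unfolding under_def underS_def by (auto dest: transD)
    qed
    have "x \<in> under ?r x" using ord(1) x(1) unfolding under_def refl_on_def by auto
    then have "x \<in> underS ?r b" using above b(4) x(1) by blast
    moreover have "e x \<subseteq> underS ?r b" using above b(3) a x(2) by blast
    ultimately have xI: "x \<in> I b" using x(2) Y(2) unfolding I_def by (simp add: ordIso_iff_ordLeq)
    have pg: "g (p b (x, l)) = c" if "l \<le> q" for l
      using p(2)[OF b(1) xI that] x(2) Y(1) by blast
    have same: "f (p b (x, l), i) = f (b, i)" if "l \<le> q" "i < s" for l i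
    proof -
      have "g (p b (x, l)) ! i = g b ! i" using pg[OF that(1)] b(2) by simp
      then show ?thesis using that(2) unfolding g_def by simp
    qed
    have "\<exists>u\<in>edge b x. u \<noteq> v \<and> f u = f v" if v: "v \<in> edge b x" for v
    proof -
      have ne: "p b (x, l) \<noteq> b" if "l \<le> q" for l
        using p_below[OF b(1) xI that] unfolding underS_def by auto
      consider i where "v = (b, i)" "i < s" | i where "v = (p b (x, 0), i)" "i < s"
        | l where "v = (p b (x, l), 0)" "l \<le> q"
        using v unfolding edge_def low_def by auto
      then show ?thesis
      proof cases
        case 1
        then show ?thesis using same[of 0 i] ne[of 0]
          by (intro bexI[of _ "(p b (x, 0), i)"]) (auto simp: edge_def low_def)
      next
        case 2
        then show ?thesis using same[of 0 i] ne[of 0]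
          by (intro bexI[of _ "(b, i)"]) (auto simp: edge_def)
      next
        case 3
        then show ?thesis using same[of l 0] ne[of l] s
          by (intro bexI[of _ "(b, 0)"]) (auto simp: edge_def)
      qed
    qed
    then show "\<exists>A\<in>G. \<forall>v\<in>A. \<exists>u\<in>A. u \<noteq> v \<and> f u = f v"
      using b(1) xI unfolding G_def by blast
  qed
  moreover have "\<Union>G \<subseteq> L \<times> UNIV"
  proof
    fix v assume "v \<in> \<Union>G"
    then obtain b x where bx: "b \<in> L" "x \<in> I b" "v \<in> edge b x" unfolding G_def by blast
    then have "fst v = b \<or> fst v \<in> underS ?r b"
      using low_below[OF bx(1,2), of v] unfolding edge_def by auto
    then have "fst v \<in> L" using bx(1) rL unfolding underS_def by auto
    then show "v \<in> L \<times> UNIV" by (cases v) simp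
  qed
  moreover have "\<forall>A\<in>G. finite A \<and> card A = k + s" using card_edge unfolding G_def by auto
  ultimately show ?thesis using ad by (intro exI[of _ G] conjI ballI impI) auto
qed

section \<open>Lower bounds along chains of cardinals, and the theorem\<close>

text \<open>The diagonal family handles \<open>i = 1\<close>, the facet family
  \<open>i \<ge> 2\<close>. Lists of \<open>k\<close> colours from the infinite set
  \<open>Q 0\<close> number at most \<open>|Q 0|\<close>, so the Erdos-Rado relation also holds for
  them.\<close>

lemma successor_system:
  fixes Q :: "nat \<Rightarrow> 'a set" and K :: "'a set"
  assumes gch: "GCH_on TYPE('a)" and i: "1 \<le> i"
    and inf: "\<And>l. l \<le> i \<Longrightarrow> infinite (Q l)"
    and succ: "\<And>l. l < i \<Longrightarrow> |Q (Suc l)| =o cardSuc |Q l|"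
    and K: "|Q i| \<le>o |K|"
    and k: "1 \<le> k" and t: "i * k < t" "t \<le> (i + 1) * k"
  shows "\<exists>F :: 'a set set. is_system F K t (k + 1) \<and> \<not> chiCF_le F (Q 0)"
proof -
  have Kinf: "infinite K" using card_of_ordLeq_infinite[OF K] inf[of i] by simp
  show ?thesis
  proof (cases "i = 1")
    case True
    have Q0: "infinite (Q 0)" and Q1: "|Q 1| =o cardSuc |Q 0|" using inf[of 0] succ[of 0] True by simp_all
    have s: "1 \<le> t - k" "t - k \<le> k" "k + (t - k) = t" "2 \<le> t" using t k True by simp_all
    obtain G :: "('a \<times> nat) set set" where G: "\<Union>G \<subseteq> Q 1 \<times> UNIV"
      "\<forall>A\<in>G. finite A \<and> card A = k + (t - k)"
      "\<forall>A\<in>G. \<forall>B\<in>G. A \<noteq> B \<longrightarrow> card (A \<inter> B) \<le> k" "no_cf G (Q 0)"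
      using diagonal_system[OF Q0 Q1 GCH_onD[OF gch Q0 Q1] s(1,2)] by blast
    have "|Q 1 \<times> (UNIV :: nat set)| \<le>o |K|"
      using K Kinf True by (intro card_of_Times_ordLeq) (simp_all add: infinite_iff_card_of_nat)
    then have "|\<Union>G| \<le>o |K|" by (rule card_of_subset_ordLeq[OF G(1)])
    then show ?thesis using G s by (intro pad_system[OF Kinf]) auto
  next
    case False
    define q where "q = t - i * k"
    have q: "1 \<le> q" "q \<le> k" "t = i * k + q" using t unfolding q_def by auto
    have "arrows (Q (Suc (i - 1))) (Suc i) (Suc (i - 1)) (Q 0)"
      using inf succ i by (intro erdos_rado[OF gch]) auto
    then have "arrows (Q i) (Suc i) i (Q 0)" using i by simp
    moreover have "|{xs. set xs \<subseteq> Q 0 \<and> length xs = k}| \<le>o |Q 0|"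
      by (rule card_of_subset_ordLeq[OF _ card_of_lists_ordLeq_infinite[OF _ card_of_mono1[OF order_refl]]])
        (auto simp: inf)
    ultimately have "arrows (Q i) (Suc i) i {xs. set xs \<subseteq> Q 0 \<and> length xs = k}"
      by (rule arrows_mono)
    then show ?thesis using q i False by (intro facets_system[OF Kinf K]) auto
  qed
qed

text \<open>A cardinal that is no successor stays above the successors of all smaller ones. These
  successors are realized by subsets of \<open>K\<close>, hence within the type
  \<open>'a\<close>.\<close>

lemma limit_cardinal_chain:
  fixes K R :: "'a set"
  assumes R: "|R| <o |K|" and lim: "\<And>B :: 'a set. \<not> |K| =o cardSuc |B|"
  shows "\<exists>Q :: nat \<Rightarrow> 'a set. Q 0 = R \<and> (\<forall>m. |Q m| <o |K| \<and> |Q (Suc m)| =o cardSuc |Q m| )"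
proof -
  have step: "\<exists>B' :: 'a set. |B'| <o |K| \<and> |B'| =o cardSuc |B|" if B: "|B| <o |K|" for B :: "'a set"
  proof -
    have Suc: "|Field (cardSuc |B| )| =o cardSuc |B|"
      by (rule card_of_Field_ordIso[OF cardSuc_Card_order[OF card_of_Card_order]])
    have "cardSuc |B| \<le>o |K|"
      by (rule cardSuc_least[OF card_of_Card_order card_of_Card_order B])
    from iffD1[OF internalize_card_of_ordLeq ordIso_ordLeq_trans[OF Suc this]]
    obtain B' where B': "B' \<subseteq> K" "|Field (cardSuc |B| )| =o |B'|" unfolding Field_card_of by blast
    have iso: "|B'| =o cardSuc |B|" by (rule ordIso_transitive[OF ordIso_symmetric[OF B'(2)] Suc])
    have "\<not> |K| =o |B'|" using lim[of B] ordIso_transitive[OF _ iso] by blast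
    then have "\<not> |K| \<le>o |B'|"
      using card_of_mono1[OF B'(1)] by (simp add: ordIso_iff_ordLeq)
    then show ?thesis using iso unfolding card_of_not_ordLeq by blast
  qed
  \<comment> \<open>The clause \<open>m = 0 \<longrightarrow> B = R\<close> pins the starting value
    of the dependent choice.\<close>
  have "\<exists>Q. Q 0 = R \<and> (\<forall>m. |Q m| <o |K| \<and> |Q (Suc m)| =o cardSuc |Q m| )"
    using dependent_nat_choice[of "\<lambda>m B. |B| <o |K| \<and> (m = 0 \<longrightarrow> B = R)"
        "\<lambda>_ B B'. |B'| =o cardSuc |B|"] R step
    by (metis nat.distinct(1))
  then show ?thesis .
qed

theorem theorem3p9:
  fixes K :: "nat \<Rightarrow> 'a set" and k n t :: nat
  assumes gch: "GCH_on TYPE('a)"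
    and kappa_inf: "infinite (K 0)"
    and kappa_lim: "(card_of (K 0), card_of (UNIV :: nat set)) \<in> ordIso \<or> (\<forall>B :: 'a set. (card_of (K 0), cardSuc (card_of B)) \<notin> ordIso)"
    and succ: "\<forall>m < n. (card_of (K (Suc m)), cardSuc (card_of (K m))) \<in> ordIso"
    and k1: "1 \<le> k"
    and tk: "k < t"
  shows "(\<forall>i \<in> {1..n}. i * k < t \<and> t \<le> (i + 1) * k \<longrightarrow>
            chiCF_sys_eq TYPE('a) (K n) t (k + 1) (K (n + 1 - i)))
       \<and> ((n + 1) * k < t \<longrightarrow> chiCF_sys_eq TYPE('a) (K n) t (k + 1) (K 0))"
proof -
  have less: "|K m| <o |K (Suc m)|" if "m < n" for m
    using ordLess_ordIso_trans[OF cardSuc_greater[OF card_of_Card_order] ordIso_symmetric] succ that by blast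
  have le: "|K (Suc m)| \<le>o cardSuc |K m|" if "m < n" for m
    using succ that by (simp add: ordIso_iff_ordLeq)
  have K0: "|K 0| \<le>o |K m|" if "m \<le> n" for m
    using that
  proof (induction m)
    case 0
    then show ?case by (simp add: card_of_mono1)
  next
    case (Suc m)
    then show ?case using ordLeq_transitive[OF _ ordLess_imp_ordLeq[OF less[of m]]] by simp
  qed
  have inf: "infinite (K m)" if "m \<le> n" for m
    using card_of_ordLeq_infinite[OF K0[OF that] kappa_inf] .
  have "chiCF_sys_eq TYPE('a) (K n) t (k + 1) (K (n + 1 - i))"
    if i: "1 \<le> i" "i \<le> n" and t: "i * k < t" "t \<le> (i + 1) * k" for i
    unfolding chiCF_sys_eq_def
  proof (intro conjI allI impI)
    fix F :: "'a set set" assume "is_system F (K n) t (k + 1)"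
    \<comment> \<open>From \<open>K (n + 1 - i)\<close> it takes \<open>i - 1\<close> successors to
      reach \<open>K n\<close>, so the required bound \<open>Suc (i - 1) * k < t\<close> is
      \<open>i * k < t\<close>.\<close>
    then show "chiCF_le F (K (n + 1 - i))"
      using chiCF_le_of_chain[of "i - 1" "\<lambda>m. K (n + 1 - i + m)" k t F] inf le i t by simp
  next
    \<comment> \<open>Fewer colours than \<open>|K (n + 1 - i)|\<close> means at most
      \<open>|K (n - i)|\<close>, from which exactly \<open>i\<close> successors lead to
      \<open>K n\<close>.\<close>
    fix R :: "'a set" assume "|R| <o |K (n + 1 - i)|"
    moreover have "|K (n + 1 - i)| \<le>o cardSuc |K (n - i)|"
      using le[of "n - i"] i by (simp add: Suc_diff_le)
    ultimately have "|R| <o cardSuc |K (n - i)|" by (rule ordLess_ordLeq_trans)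
    then have R: "|R| \<le>o |K (n - i)|"
      using cardSuc_ordLeq_ordLess[OF card_of_Card_order card_of_Card_order] by blast
    have "\<exists>F :: 'a set set. is_system F (K n) t (k + 1) \<and> \<not> chiCF_le F (K (n - i + 0))"
    proof (rule successor_system[OF gch i(1), of "\<lambda>m. K (n - i + m)"])
      show "|K (n - i + i)| \<le>o |K n|" using i by (simp add: card_of_mono1)
    qed (use inf succ i k1 t in auto)
    then obtain F :: "'a set set" where "is_system F (K n) t (k + 1)" "\<not> chiCF_le F (K (n - i))" by auto
    then show "\<exists>F :: 'a set set. is_system F (K n) t (k + 1) \<and> \<not> chiCF_le F R"
      using chiCF_le_mono[OF _ R] by blast
  qed
  moreover have "chiCF_sys_eq TYPE('a) (K n) t (k + 1) (K 0)" if t: "(n + 1) * k < t"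
    unfolding chiCF_sys_eq_def
  proof (intro conjI allI impI)
    fix F :: "'a set set" assume "is_system F (K n) t (k + 1)"
    then show "chiCF_le F (K 0)" using chiCF_le_of_chain[of n K k t F] inf le t by simp
  next
    fix R :: "'a set" assume R: "|R| <o |K 0|"
    show "\<exists>F :: 'a set set. is_system F (K n) t (k + 1) \<and> \<not> chiCF_le F R"
    \<comment> \<open>Finite \<open>R\<close> covers \<open>\<kappa> = \<omega>\<close>. An infinite
      \<open>R\<close> makes \<open>\<kappa>\<close> an uncountable limit, with room for any finite
      number of successors above \<open>|R|\<close>.\<close>
    proof (cases "finite R")
      case True
      then show ?thesis using k1 tk inf[of n] by (intro finite_colors_system) auto
    next
      case False
      then have "|UNIV :: nat set| \<le>o |R|" by (simp add: infinite_iff_card_of_nat)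
      then have "|UNIV :: nat set| <o |K 0|" by (rule ordLeq_ordLess_trans[OF _ R])
      then have "\<not> |K 0| =o |UNIV :: nat set|"
        using not_ordLess_ordIso ordIso_symmetric by blast
      then obtain Q :: "nat \<Rightarrow> 'a set" where Q: "Q 0 = R"
          "\<And>m. |Q m| <o |K 0|" "\<And>m. |Q (Suc m)| =o cardSuc |Q m|"
        using limit_cardinal_chain[OF R] kappa_lim by blast
      have Qinf: "infinite (Q m)" for m
      proof (induction m)
        case 0
        then show ?case using Q(1) False by simp
      next
        case (Suc m)
        have "|Q m| <o |Q (Suc m)|"
          by (rule ordLess_ordIso_trans[OF cardSuc_greater[OF card_of_Card_order] ordIso_symmetric[OF Q(3)]])
        then show ?case by (rule card_of_ordLeq_infinite[OF ordLess_imp_ordLeq Suc])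
      qed
      \<comment> \<open>With \<open>t - 1\<close> in the quotient, \<open>i\<close> satisfies
        \<open>i * k < t \<le> (i + 1) * k\<close>, the upper end included.\<close>
      define i where "i = (t - 1) div k"
      have "i * k \<le> t - 1" "t - 1 < Suc i * k"
        using k1 unfolding i_def by (auto simp: dividend_less_div_times)
      moreover have "1 \<le> i" using tk k1 unfolding i_def by (simp add: Suc_le_eq div_greater_zero_iff)
      moreover have "|Q i| \<le>o |K n|"
        by (rule ordLeq_transitive[OF ordLess_imp_ordLeq[OF Q(2)] K0]) simp
      ultimately have "\<exists>F :: 'a set set. is_system F (K n) t (k + 1) \<and> \<not> chiCF_le F (Q 0)"
        using k1 tk by (intro successor_system[of i Q "K n" k t] gch Qinf Q(3)) simp_all
      then show ?thesis using Q(1) by simp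
    qed
  qed
  ultimately show ?thesis by simp
qed

end
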